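(* For every graph class $\mathcal{C}$ of bounded expansion and every $d\in\mathbb{N}$, there exist a constant $c$ and a linear-time algorithm that, given a graph $H\in\overline{\mathcal{C}^d}$, computes a proper coloring of $H$ using at most $c\cdot\chi(H)$ colors.
   Context: All graphs are finite, simple and undirected. $G^d$ is the graph on $V(G)$ where distinct $u,v$ are adjacent iff their distance in $G$ is at most $d$; $\mathcal{C}^d=\{G^d:G\in\mathcal{C}\}$; $\overline{\mathcal{D}}$ denotes the class of all induced subgraphs of graphs in $\mathcal{D}$. $\chi$ is the chromatic number. Running time is measured in the input size $|V(H)|+|E(H)|$. A graph is a depth-$r$ minor of $G$ if it is obtained from a subgraph of $G$ by contracting pairwise disjoint connected subgraphs of radius at most $r$; a class $\mathcal{C}$ has bounded expansion if for every $r\in\mathbb{N}$ the ratio of edges to vertices of depth-$r$ minors of graphs in $\mathcal{C}$ is bounded. *)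

theory Defs
  imports "Graph_Theory.Graph_Theory" "HOL-Library.Disjoint_Sets"
begin

section \<open>Graphs\<close>

text \<open>
  A finite simple undirected graph is a \<open>pair_graph\<close>: a finite, loop-free digraph without
  parallel arcs whose arc relation is symmetric. Each undirected edge is thus a pair of opposite
  arcs, and edges are counted through the following set of two-element sets.
\<close>

definition edges :: "'a pair_pre_digraph \<Rightarrow> 'a set set" where
  "edges G = (\<lambda>(u, v). {u, v}) ` parcs G"

text \<open>The distance is infinite if there is no walk.\<close>

definition distance :: "'a pair_pre_digraph \<Rightarrow> 'a \<Rightarrow> 'a \<Rightarrow> ereal" where
  "distance G u v = wf_digraph.\<mu> (with_proj G) (\<lambda>_. 1) u v"

definition radius :: "'a pair_pre_digraph \<Rightarrow> ereal" where
  "radius G = (INF z\<in>pverts G. SUP v\<in>pverts G. distance G z v)"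

definition graph_power :: "'a pair_pre_digraph \<Rightarrow> nat \<Rightarrow> 'a pair_pre_digraph" where
  "graph_power G d = \<lparr> pverts = pverts G,
     parcs = {(u, v). u \<in> pverts G \<and> v \<in> pverts G \<and> u \<noteq> v \<and> distance G u v \<le> ereal (real d)} \<rparr>"

definition class_power :: "'a pair_pre_digraph set \<Rightarrow> nat \<Rightarrow> 'a pair_pre_digraph set" where
  "class_power C d = {graph_power G d | G. G \<in> C}"

definition induced_closure :: "'a pair_pre_digraph set \<Rightarrow> 'a pair_pre_digraph set" where
  "induced_closure D = {H. \<exists>G\<in>D. induced_subgraph (with_proj H) (with_proj G)}"

definition proper_coloring :: "'a pair_pre_digraph \<Rightarrow> ('a \<Rightarrow> nat) \<Rightarrow> bool" where
  "proper_coloring G f \<longleftrightarrow> (\<forall>(u, v)\<in>parcs G. f u \<noteq> f v)"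

definition chromatic_number :: "'a pair_pre_digraph \<Rightarrow> nat" where
  "chromatic_number G = (LEAST k. \<exists>f. proper_coloring G f \<and> f ` pverts G \<subseteq> {..<k})"


section \<open>Shallow minors and bounded expansion\<close>

text \<open>The parts in \<open>P\<close> become the vertices; loops and parallel edges are dropped.\<close>

definition contract :: "'a pair_pre_digraph \<Rightarrow> 'a set set \<Rightarrow> 'a set pair_pre_digraph" where
  "contract S P = \<lparr> pverts = P,
     parcs = {(X, Y). X \<in> P \<and> Y \<in> P \<and> X \<noteq> Y \<and> (\<exists>x\<in>X. \<exists>y\<in>Y. (x, y) \<in> parcs S)} \<rparr>"

text \<open>
  The contracted subgraphs \<open>F\<close> are pairwise disjoint because their vertex sets are the parts of a
  partition. A vertex that is not contracted forms a one-vertex part, whose radius is 0, so it is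
  no restriction that the parts cover all of \<open>S\<close>. Every depth-\<open>r\<close> minor is isomorphic to a graph
  of this form.
\<close>

definition depth_minors :: "nat \<Rightarrow> 'a pair_pre_digraph \<Rightarrow> 'a set pair_pre_digraph set" where
  "depth_minors r G = {contract S P | S P.
     pair_graph S \<and> subgraph (with_proj S) (with_proj G) \<and>
     partition_on (pverts S) P \<and>
     (\<forall>X\<in>P. \<exists>F. pair_graph F \<and> subgraph (with_proj F) (with_proj S) \<and> pverts F = X \<and>
        Digraph_Component.connected (with_proj F) \<and> radius F \<le> ereal (real r))}"

definition bounded_expansion :: "'a pair_pre_digraph set \<Rightarrow> bool" where
  "bounded_expansion C \<longleftrightarrow>
     (\<forall>r. \<exists>b::real. \<forall>G\<in>C. \<forall>M\<in>depth_minors r G.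
        real (card (edges M)) \<le> b * real (card (pverts M)))"


section \<open>Random access machine\<close>

text \<open>
  Programs of a unit-cost RAM, with structured control flow instead of jumps. A program refers to
  finitely many registers, given by their numbers; the memory is accessed only indirectly, at
  addresses held in registers. There is no multiplication, division or bit operation.
\<close>

datatype ram =
    Const nat nat              \<comment> \<open>\<open>r := n\<close>\<close>
  | Add nat nat nat            \<comment> \<open>\<open>r := a + b\<close>\<close>
  | Sub nat nat nat            \<comment> \<open>\<open>r := a - b\<close>, truncated at 0\<close>
  | Load nat nat               \<comment> \<open>\<open>r := mem[a]\<close>\<close>
  | Store nat nat              \<comment> \<open>\<open>mem[a] := b\<close>\<close>
  | Seq ram ram
  | IfLess nat nat ram ram     \<comment> \<open>\<open>if a < b\<close>\<close>
  | WhileLess nat nat ram      \<comment> \<open>\<open>while a < b\<close>\<close>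

type_synonym ram_state = "(nat \<Rightarrow> nat) \<times> (nat \<Rightarrow> nat)"

text \<open>
  \<open>exec W p s t s'\<close>: started in state \<open>s\<close> (registers and memory), \<open>p\<close> halts in state \<open>s'\<close> after
  \<open>t\<close> steps, each elementary instruction and each evaluation of a test being one step. No word
  exceeds \<open>W\<close>: there is no execution of an instruction whose result is larger than \<open>W\<close>.
\<close>

inductive exec :: "nat \<Rightarrow> ram \<Rightarrow> ram_state \<Rightarrow> nat \<Rightarrow> ram_state \<Rightarrow> bool" for W :: nat where
  Const: "n \<le> W \<Longrightarrow> exec W (Const r n) (R, M) 1 (R(r := n), M)"
| Add: "R a + R b \<le> W \<Longrightarrow> exec W (Add r a b) (R, M) 1 (R(r := R a + R b), M)"
| Sub: "exec W (Sub r a b) (R, M) 1 (R(r := R a - R b), M)"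
| Load: "exec W (Load r a) (R, M) 1 (R(r := M (R a)), M)"
| Store: "exec W (Store a b) (R, M) 1 (R, M(R a := R b))"
| Seq: "exec W p s t s' \<Longrightarrow> exec W q s' u s'' \<Longrightarrow> exec W (Seq p q) s (t + u) s''"
| IfTrue: "R a < R b \<Longrightarrow> exec W p (R, M) t s' \<Longrightarrow> exec W (IfLess a b p q) (R, M) (Suc t) s'"
| IfFalse: "\<not> R a < R b \<Longrightarrow> exec W q (R, M) t s' \<Longrightarrow> exec W (IfLess a b p q) (R, M) (Suc t) s'"
| WhileTrue: "R a < R b \<Longrightarrow> exec W p (R, M) t s' \<Longrightarrow> exec W (WhileLess a b p) s' u s'' \<Longrightarrow>
    exec W (WhileLess a b p) (R, M) (Suc (t + u)) s''"
| WhileFalse: "\<not> R a < R b \<Longrightarrow> exec W (WhileLess a b p) (R, M) 1 (R, M)"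

text \<open>Time and result of a run are unique, so a run can be specified by an existential statement.\<close>

inductive_cases exec_elims:
  "exec W (Const r n) s t s'" "exec W (Add r a b) s t s'" "exec W (Sub r a b) s t s'"
  "exec W (Load r a) s t s'" "exec W (Store a b) s t s'" "exec W (Seq p q) s t s'"
  "exec W (IfLess a b p q) s t s'" "exec W (WhileLess a b p) s t s'"

lemma exec_deterministic:
  "exec W p s t s' \<Longrightarrow> exec W p s u s'' \<Longrightarrow> t = u \<and> s' = s''"
proof (induction arbitrary: u s'' rule: exec.induct)
  case (Const n r R M)
  then show ?case by (auto elim: exec_elims(1))
next
  case (Add R a b r M)
  then show ?case by (auto elim: exec_elims(2))
next
  case (Sub r a b R M)
  then show ?case by (auto elim: exec_elims(3))
next
  case (Load r a R M)
  then show ?case by (auto elim: exec_elims(4))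
next
  case (Store a b R M)
  then show ?case by (auto elim: exec_elims(5))
next
  case (Seq p s t s1 q v s2)
  from Seq.prems show ?case
  proof (rule exec_elims(6))
    fix t' s1' u'
    assume "u = t' + u'" "exec W p s t' s1'" "exec W q s1' u' s''"
    then show ?thesis using Seq.IH by metis
  qed
next
  case (IfTrue R a b p M t s' q)
  from IfTrue.prems show ?case
    by (rule exec_elims(7)) (use IfTrue.IH IfTrue.hyps(1) in auto)
next
  case (IfFalse R a b q M t s' p)
  from IfFalse.prems show ?case
    by (rule exec_elims(7)) (use IfFalse.IH IfFalse.hyps(1) in auto)
next
  case (WhileTrue R a b p M t s1 v s2)
  from WhileTrue.prems show ?case
  proof (rule exec_elims(8))
    fix R' M' t' s1' u'
    assume "(R, M) = (R', M')" "u = Suc (t' + u')" "exec W p (R', M') t' s1'"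
      "exec W (WhileLess a b p) s1' u' s''"
    then show ?thesis using WhileTrue.IH by (metis prod.inject)
  next
    fix R' M' assume "(R, M) = (R', M')" "\<not> R' a < R' b"
    then show ?thesis using WhileTrue.hyps(1) by simp
  qed
next
  case (WhileFalse R a b p M)
  from WhileFalse.prems show ?case
    by (rule exec_elims(8)) (use WhileFalse.hyps in auto)
qed

text \<open>
  Input and output are lists stored in memory from address 0 on, with their length in register 0.
  Everything else is initially 0.
\<close>

definition run :: "nat \<Rightarrow> ram \<Rightarrow> nat list \<Rightarrow> nat \<Rightarrow> nat list \<Rightarrow> bool" where
  "run W p xs t ys \<longleftrightarrow>
     length xs \<le> W \<and> (\<forall>x\<in>set xs. x \<le> W) \<and>
     (\<exists>R M. exec W p
        ((\<lambda>r. if r = 0 then length xs else 0), (\<lambda>i. if i < length xs then xs ! i else 0)) t (R, M) \<and>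
        ys = map M [0..<R 0])"


section \<open>Linear-time graph algorithms\<close>

text \<open>
  \<open>xs\<close> encodes \<open>H\<close> by adjacency lists. The list \<open>vs\<close> is the numbering of the vertices used, and the
  neighbours of each vertex are listed in an arbitrary order. The number of vertices comes first,
  followed by the adjacency lists, each of which is preceded by its length.
\<close>

definition adjacency_encoding :: "'a pair_pre_digraph \<Rightarrow> 'a list \<Rightarrow> nat list \<Rightarrow> bool" where
  "adjacency_encoding H vs xs \<longleftrightarrow>
     distinct vs \<and> set vs = pverts H \<and>
     (\<exists>Ns. length Ns = length vs \<and>
        (\<forall>i<length vs. distinct (Ns ! i) \<and>
           set (Ns ! i) = {j. j < length vs \<and> (vs ! i, vs ! j) \<in> parcs H}) \<and>
        xs = length vs # concat (map (\<lambda>N. length N # N) Ns))"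

definition graph_size :: "'a pair_pre_digraph \<Rightarrow> nat" where
  "graph_size H = card (pverts H) + card (edges H)"

text \<open>
  On every encoding of every graph \<open>H\<close> in \<open>D\<close>, the program \<open>p\<close> halts after a number of steps linear
  in the size \<open>N\<close> of \<open>H\<close>, using words of \<open>O(log N)\<close> bits, with an output \<open>ys\<close> that satisfies
  \<open>Q H vs ys\<close> for the numbering \<open>vs\<close> of the input. Nothing is required on other inputs. As the
  numbering is arbitrary, it does not matter whether \<open>D\<close> is closed under isomorphism.
\<close>

definition linear_time_algorithm ::
  "ram \<Rightarrow> 'a pair_pre_digraph set \<Rightarrow> ('a pair_pre_digraph \<Rightarrow> 'a list \<Rightarrow> nat list \<Rightarrow> bool) \<Rightarrow> bool" where
  "linear_time_algorithm p D Q \<longleftrightarrow>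
     (\<exists>a b k. \<forall>H\<in>D. \<forall>vs xs. adjacency_encoding H vs xs \<longrightarrow>
        (\<exists>t ys. run ((graph_size H + 2) ^ k) p xs t ys \<and> t \<le> a * graph_size H + b \<and> Q H vs ys))"

text \<open>The output lists the colors of the vertices in the order of the input numbering.\<close>

definition coloring_output ::
  "real \<Rightarrow> 'a pair_pre_digraph \<Rightarrow> 'a list \<Rightarrow> nat list \<Rightarrow> bool" where
  "coloring_output c H vs ys \<longleftrightarrow>
     (\<exists>f. ys = map f vs \<and> proper_coloring H f \<and>
        real (card (f ` pverts H)) \<le> c * real (chromatic_number H))"

end

theory Submission
  imports Defs
begin

text \<open>
  Let \<open>H\<close> be an induced subgraph of \<open>G\<^sup>d\<close>, let \<open>r = d div 2\<close>, and let \<open>k = \<chi>(H)\<close>. A ball of radius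
  \<open>r\<close> in \<open>G\<close> meets \<open>V(H)\<close> in a clique of \<open>H\<close>, hence in at most \<open>k\<close> vertices. Given a set \<open>X\<close> of
  vertices of \<open>H\<close>, choose a random \<open>Y \<subseteq> X\<close> with probability \<open>1/(2k)\<close> for each vertex, and contract
  the Voronoi cells of \<open>Y\<close>, cut off at distance \<open>r\<close>. An edge \<open>uw\<close> of \<open>H[X]\<close> with \<open>u, w \<in> Y\<close> yields an
  edge of this depth-\<open>r\<close> minor if no other vertex of \<open>Y\<close> lies in a ball of radius \<open>r\<close> around the at
  most \<open>d + 1\<close> vertices of a path from \<open>u\<close> to \<open>w\<close>, which has conditional probability at least
  \<open>2^-(d+1)\<close>. As the minor is sparse on average, \<open>H[X]\<close> has \<open>O(k |X|)\<close> edges.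

  It remains to color in linear time with \<open>O(q)\<close> colors a graph whose induced subgraphs all have
  average degree at most \<open>q\<close>. Go repeatedly through the list of the remaining vertices and remove
  those of current degree at most \<open>T\<close>; if fewer than half of them were removed, increase \<open>T\<close> by one.
  Such a round shows that more than half of the vertices had degree at least \<open>T + 1\<close>, so
  \<open>T + 1 \<le> 2q\<close>. It is paid for by the vertices that survive it, each of which has degree more
  than \<open>T\<close>; any other round is paid for by the vertices that it removes. Greedy coloring in the
  reverse order of removal uses at most \<open>T + 1\<close> colors.
\<close>

section \<open>Distances and Voronoi cells\<close>

lemma awalk_imp_relpow:
  assumes "set p \<subseteq> parcs G" "pcas u p v"
  shows "(u, v) \<in> parcs G ^^ length p"
  using assms
proof (induction p arbitrary: u)
  case (Cons e p)
  then have "(u, snd e) \<in> parcs G" "(snd e, v) \<in> parcs G ^^ length p"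
    by auto
  then show ?case using relpow_Suc_I2 by fastforce
qed simp

lemma relpow_imp_awalk:
  assumes "(u, v) \<in> parcs G ^^ n"
  shows "\<exists>p. set p \<subseteq> parcs G \<and> pcas u p v \<and> length p = n"
  using assms
proof (induction n arbitrary: u)
  case (Suc n)
  then obtain x where "(u, x) \<in> parcs G" "(x, v) \<in> parcs G ^^ n"
    by (meson relpow_Suc_E2)
  then obtain p where "set p \<subseteq> parcs G" "pcas x p v" "length p = n"
    using Suc.IH by blast
  then show ?case using \<open>(u, x) \<in> parcs G\<close> by (intro exI[of _ "(u, x) # p"]) auto
qed (intro exI[of _ "[]"], simp)

lemma relpow_in_verts:
  assumes "pair_wf_digraph G" "(u, v) \<in> parcs G ^^ n" "u \<in> pverts G"
  shows "v \<in> pverts G"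
  using assms(2,3) pair_wf_digraph.in_arcsD2[OF assms(1)]
  by (cases n) (auto simp: relcomp_unfold)

text \<open>Walks have natural lengths, so the infimum can be replaced by the existence of a walk.
  The rest of the proof works with powers of the arc relation instead of extended reals.\<close>

lemma distance_le_iff:
  assumes "pair_wf_digraph G" "u \<in> pverts G"
  shows "distance G u v \<le> ereal (real d) \<longleftrightarrow> (\<exists>i\<le>d. (u, v) \<in> parcs G ^^ i)"
proof -
  interpret pair_wf_digraph G by fact
  have cost: "awalk_cost (\<lambda>_. 1) p = real (length p)" for p
    by (induction p) auto
  have dist: "distance G u v = (INF p\<in>{p. awalk u p v}. ereal (real (length p)))"
    by (simp add: distance_def \<mu>_def cost)
  show ?thesis
  proof
    assume le: "distance G u v \<le> ereal (real d)"
    \<comment> \<open>Strictness below \<open>d + 1\<close> lets the infimum yield a walk;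
      integrality brings its length back to \<open>d\<close>.\<close>
    have "distance G u v < ereal (real d + 1)"
      using le by (rule order_le_less_trans) simp
    then obtain p where "awalk u p v" "real (length p) < real d + 1"
      unfolding dist INF_less_iff by auto
    moreover then have "length p \<le> d" by linarith
    ultimately show "\<exists>i\<le>d. (u, v) \<in> parcs G ^^ i"
      by (auto simp: awalk_def intro!: exI[of _ "length p"] awalk_imp_relpow)
  next
    assume "\<exists>i\<le>d. (u, v) \<in> parcs G ^^ i"
    then obtain i where "i \<le> d" "(u, v) \<in> parcs G ^^ i" by blast
    then obtain p where "set p \<subseteq> parcs G" "pcas u p v" "length p = i"
      by (meson relpow_imp_awalk)
    then have "awalk u p v" "length p \<le> d"
      using assms(2) \<open>i \<le> d\<close> by (auto simp: awalk_def)
    then show "distance G u v \<le> ereal (real d)"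
      unfolding dist by (intro INF_lower2[of p]) auto
  qed
qed

section \<open>Arcs versus edges, and the conditions behind \<open>pair_graph\<close>\<close>

lemma card_arcs_eq:
  assumes "finite (parcs G)" "sym (parcs G)" "irrefl (parcs G)"
  shows "card (parcs G) = 2 * card (edges G)"
proof -
  have "card {x \<in> parcs G. (\<lambda>(u, v). {u, v}) x = e} = 2" if e: "e \<in> edges G" for e
  proof -
    obtain u v where uv: "(u, v) \<in> parcs G" "e = {u, v}"
      using e unfolding edges_def by auto
    then have "(v, u) \<in> parcs G" "u \<noteq> v"
      using assms(2,3) by (auto simp: sym_def irrefl_def)
    then have "{x \<in> parcs G. (\<lambda>(u, v). {u, v}) x = e} = {(u, v), (v, u)}"
      using uv by (auto simp: doubleton_eq_iff)
    then show ?thesis using \<open>u \<noteq> v\<close> by simp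
  qed
  then have "(\<Sum>e\<in>edges G. card {x \<in> parcs G. (\<lambda>(u, v). {u, v}) x = e}) = 2 * card (edges G)"
    by simp
  moreover have "(\<Sum>e\<in>edges G. card {x \<in> parcs G. (\<lambda>(u, v). {u, v}) x = e}) = card (parcs G)"
    using sum.image_gen[OF assms(1), of "\<lambda>_. 1::nat" "\<lambda>(u, v). {u, v}"]
    by (simp add: edges_def)
  ultimately show ?thesis by simp
qed

lemma pair_graphD:
  assumes "pair_graph G"
  shows "finite (pverts G)" "finite (parcs G)" "sym (parcs G)" "irrefl (parcs G)"
    "parcs G \<subseteq> pverts G \<times> pverts G" "pair_wf_digraph G"
proof -
  interpret pair_graph G by fact
  show "finite (pverts G)" "finite (parcs G)" by (fact pair_finite_verts pair_finite_arcs)+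
  show "sym (parcs G)" by (auto intro!: symI arcs_symmetric)
  show "irrefl (parcs G)" using no_loops' by (auto simp: irrefl_def)
  show "parcs G \<subseteq> pverts G \<times> pverts G" by (auto dest: in_arcsD1 in_arcsD2)
  show "pair_wf_digraph G" by unfold_locales
qed

lemma pair_graphI:
  assumes "finite (pverts G)" "sym (parcs G)" "irrefl (parcs G)"
    "parcs G \<subseteq> pverts G \<times> pverts G"
  shows "pair_graph G"
proof
  show "finite (parcs G)" by (rule finite_subset[OF assms(4)]) (use assms(1) in auto)
  show "symmetric (with_proj G)" using assms(2) by (simp add: symmetric_def)
qed (use assms in \<open>auto simp: irrefl_def\<close>)

text \<open>
  A Voronoi cell, cut off at distance \<open>r\<close>. Ties between centres at equal distance are broken by
  \<open>\<iota>\<close>: as \<open>\<iota>\<close> is below \<open>N\<close>, the keys \<open>i * N + \<iota> y\<close> are ordered lexicographically.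
\<close>

definition voronoi ::
  "'a rel \<Rightarrow> nat \<Rightarrow> ('a \<Rightarrow> nat) \<Rightarrow> nat \<Rightarrow> 'a set \<Rightarrow> 'a \<Rightarrow> 'a set" where
  "voronoi E N \<iota> r Y y = {a. \<exists>i\<le>r. (y, a) \<in> E ^^ i \<and>
     (\<forall>z\<in>Y. \<forall>j. (z, a) \<in> E ^^ j \<longrightarrow> i * N + \<iota> y \<le> j * N + \<iota> z)}"

text \<open>At a common point both keys are minimal, hence equal; their residues modulo
  \<open>N\<close> are \<open>\<iota> y\<close> and \<open>\<iota> z\<close>, and \<iota> is
  injective.\<close>

lemma voronoi_disjoint:
  assumes "inj_on \<iota> Y" "\<And>y. y \<in> Y \<Longrightarrow> \<iota> y < N" "y \<in> Y" "z \<in> Y" "y \<noteq> z"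
  shows "voronoi E N \<iota> r Y y \<inter> voronoi E N \<iota> r Y z = {}"
proof (rule ccontr)
  assume "voronoi E N \<iota> r Y y \<inter> voronoi E N \<iota> r Y z \<noteq> {}"
  then obtain a i j where "(y, a) \<in> E ^^ i" "(z, a) \<in> E ^^ j"
    "\<forall>z\<in>Y. \<forall>j. (z, a) \<in> E ^^ j \<longrightarrow> i * N + \<iota> y \<le> j * N + \<iota> z"
    "\<forall>y\<in>Y. \<forall>i. (y, a) \<in> E ^^ i \<longrightarrow> j * N + \<iota> z \<le> i * N + \<iota> y"
    unfolding voronoi_def by blast
  then have "i * N + \<iota> y = j * N + \<iota> z"
    using assms(3,4) by (meson order_antisym)
  then have "(i * N + \<iota> y) mod N = (j * N + \<iota> z) mod N" by simp
  then have "\<iota> y = \<iota> z" using assms(2-4) by simp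
  then show False using assms(1,3-5) by (auto dest: inj_onD)
qed

text \<open>At length 0 only \<open>y\<close> itself competes, and a longer walk has a key of at
  least \<open>N\<close>, which exceeds \<open>\<iota> y\<close>.\<close>

lemma voronoi_centre:
  assumes "\<And>y. y \<in> Y \<Longrightarrow> \<iota> y < N" "y \<in> Y"
  shows "y \<in> voronoi E N \<iota> r Y y"
proof -
  have "\<iota> y \<le> j * N + \<iota> z" if "z \<in> Y" "(z, y) \<in> E ^^ j" for z j
    using that assms(1)[OF assms(2)] by (cases j) auto
  then show ?thesis unfolding voronoi_def by (auto intro!: exI[of _ 0])
qed

text \<open>A better key at the predecessor \<open>b\<close> would give a better one at
  \<open>a\<close>, so a walk that realizes the minimal key stays in the cell. This makes the cell
  connected and of radius at most \<open>r\<close>.\<close>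

lemma voronoi_walk:
  assumes "a \<in> voronoi E N \<iota> r Y y"
  shows "\<exists>i\<le>r. (y, a) \<in> (E \<inter> voronoi E N \<iota> r Y y \<times> voronoi E N \<iota> r Y y) ^^ i"
proof -
  let ?C = "voronoi E N \<iota> r Y y"
  have "(y, a) \<in> (E \<inter> ?C \<times> ?C) ^^ i"
    if "(y, a) \<in> E ^^ i" "i \<le> r" "\<forall>z\<in>Y. \<forall>j. (z, a) \<in> E ^^ j \<longrightarrow> i * N + \<iota> y \<le> j * N + \<iota> z" for i a
    using that
  proof (induction i arbitrary: a)
    case (Suc i)
    then obtain b where b: "(y, b) \<in> E ^^ i" "(b, a) \<in> E" by auto
    have min: "i * N + \<iota> y \<le> j * N + \<iota> z" if "z \<in> Y" "(z, b) \<in> E ^^ j" for z j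
      using Suc.prems(3) that b(2) relpow_Suc_I[OF that(2) b(2)] by fastforce
    then have "(y, b) \<in> (E \<inter> ?C \<times> ?C) ^^ i"
      using Suc.IH b(1) Suc.prems(2) by simp
    moreover have "b \<in> ?C" "a \<in> ?C"
      using b(1) min Suc.prems unfolding voronoi_def by (blast intro: Suc_leD)+
    ultimately show ?case using b(2) by auto
  qed simp
  then show ?thesis using assms unfolding voronoi_def by blast
qed

text \<open>The centre of least key for \<open>a\<close> is within distance \<open>r\<close>,
  because \<open>u\<close> is, and by \<open>only\<close> it is one of \<open>v\<close> and
  \<open>w\<close>.\<close>

lemma voronoi_cover:
  assumes "u \<in> Y" "(u, a) \<in> E ^^ m" "m \<le> r" "\<And>y. y \<in> Y \<Longrightarrow> \<iota> y < N"
    and only: "\<And>y j. y \<in> Y \<Longrightarrow> (y, a) \<in> E ^^ j \<Longrightarrow> j \<le> r \<Longrightarrow> y = v \<or> y = w"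
  shows "a \<in> voronoi E N \<iota> r Y v \<union> voronoi E N \<iota> r Y w"
proof -
  let ?P = "\<lambda>(j, y). y \<in> Y \<and> (y, a) \<in> E ^^ j"
  let ?k = "\<lambda>(j, y). j * N + \<iota> y"
  obtain j y where jy: "?P (j, y)" and min: "\<And>x. ?P x \<Longrightarrow> ?k (j, y) \<le> ?k x"
    using ex_has_least_nat[of ?P "(m, u)" ?k] assms(1,2) by auto
  have "j * N + \<iota> y \<le> m * N + \<iota> u" using min[of "(m, u)"] assms(1,2) by simp
  \<comment> \<open>As \<open>\<iota> u\<close> is below \<open>N\<close>, a key of at most
    \<open>m * N + \<iota> u\<close> forces \<open>j \<le> m\<close>.\<close>
  then have "j * N < (m + 1) * N" using assms(4)[OF assms(1)] by simp
  then have "j < m + 1" by (rule mult_less_cancel2[THEN iffD1, THEN conjunct2])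
  then have "j \<le> r" using assms(3) by simp
  moreover have "y \<in> {v, w}" using only[of y j] jy \<open>j \<le> r\<close> by auto
  ultimately show ?thesis using jy min unfolding voronoi_def by fastforce
qed

lemma path_crossing:
  assumes "f 0 \<in> A" "f n \<in> B" "\<And>i. i \<le> n \<Longrightarrow> f i \<in> A \<union> B"
    "A \<inter> B = {}"
  shows "\<exists>i<n. f i \<in> A \<and> f (Suc i) \<in> B"
  using assms
proof (induction n)
  case (Suc n)
  show ?case
  proof (cases "f n \<in> A")
    case True
    then show ?thesis using Suc.prems(2) by blast
  next
    case False
    then have "f n \<in> B" using Suc.prems(3)[of n] by simp
    then obtain i where "i < n" "f i \<in> A" "f (Suc i) \<in> B"
      using Suc.IH Suc.prems by (meson le_SucI)
    then show ?thesis using less_SucI by blast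
  qed
qed auto

section \<open>Cells as the parts of a shallow minor\<close>

lemma radius_le:
  assumes "pair_wf_digraph F" "y \<in> pverts F"
    and "\<And>a. a \<in> pverts F \<Longrightarrow> \<exists>i\<le>r. (y, a) \<in> parcs F ^^ i"
  shows "radius F \<le> ereal (real r)"
  unfolding radius_def
proof (rule INF_lower2[OF assms(2)], rule SUP_least)
  fix a assume "a \<in> pverts F"
  then show "distance F y a \<le> ereal (real r)"
    using assms by (simp add: distance_le_iff)
qed

text \<open>Reachability from \<open>y\<close> suffices since the arcs are symmetric; for the same
  reason the symmetrization in the definition of connectedness changes nothing.\<close>

lemma connectedI_centre:
  assumes "pair_graph F" "y \<in> pverts F"
    and "\<And>a. a \<in> pverts F \<Longrightarrow> \<exists>i. (y, a) \<in> parcs F ^^ i"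
  shows "Digraph_Component.connected (with_proj F)"
proof -
  interpret pair_graph F by fact
  have "mk_symmetric (with_proj F) = F"
    by (auto simp: mk_symmetric_def arcs_symmetric intro!: pair_pre_digraph.equality)
  moreover have reach: "y \<rightarrow>\<^sup>*\<^bsub>with_proj F\<^esub> a" if a: "a \<in> pverts F" for a
  proof -
    obtain i where "(y, a) \<in> parcs F ^^ i" using assms(3) a by blast
    then obtain p where "set p \<subseteq> parcs F" "pcas y p a" by (meson relpow_imp_awalk)
    then have "awalk y p a" using assms(2) by (simp add: awalk_def)
    then show ?thesis by (auto simp: reachable_awalk)
  qed
  have "u \<rightarrow>\<^sup>*\<^bsub>with_proj F\<^esub> v" if "u \<in> pverts F" "v \<in> pverts F" for u v
    using reach[OF that(1)] reach[OF that(2)] symmetric_reachable[OF sym_arcs]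
    by (meson reachable_trans)
  ultimately show ?thesis
    using assms(2) by (auto simp: Digraph_Component.connected_def strongly_connected_def)
qed

definition induced :: "'a pair_pre_digraph \<Rightarrow> 'a set \<Rightarrow> 'a pair_pre_digraph" where
  "induced G A = \<lparr> pverts = A, parcs = parcs G \<inter> A \<times> A \<rparr>"

lemma pair_graph_induced:
  assumes "pair_graph G" "A \<subseteq> pverts G"
  shows "pair_graph (induced G A)"
  using pair_graphD[OF assms(1)] assms(2)
  by (intro pair_graphI) (auto simp: induced_def sym_def irrefl_def intro: finite_subset)

lemma subgraph_induced:
  assumes "pair_graph G" "A \<subseteq> B" "B \<subseteq> pverts G"
  shows "subgraph (with_proj (induced G A)) (with_proj (induced G B))"
proof -
  have "pair_wf_digraph (induced G A)" "pair_wf_digraph (induced G B)"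
    using assms by (auto intro!: pair_graphD(6) pair_graph_induced)
  then show ?thesis using assms(2)
    by (auto simp: subgraph_def compatible_def wf_digraph_wp_iff induced_def)
qed

lemma subgraph_induced_self:
  assumes "pair_graph G" "B \<subseteq> pverts G"
  shows "subgraph (with_proj (induced G B)) (with_proj G)"
proof -
  have "pair_wf_digraph (induced G B)" "pair_wf_digraph G"
    using assms by (auto intro!: pair_graphD(6) pair_graph_induced)
  then show ?thesis using assms(2)
    by (auto simp: subgraph_def compatible_def wf_digraph_wp_iff induced_def)
qed

text \<open>Each cell induces its own witness \<open>F\<close>: by \<open>voronoi_walk\<close> the
  centre reaches everything inside the cell in at most \<open>r\<close> steps.\<close>

lemma voronoi_depth_minor:
  fixes r :: nat
  assumes G: "pair_graph G" and Y: "Y \<subseteq> pverts G"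
    and \<iota>: "inj_on \<iota> Y" "\<And>y. y \<in> Y \<Longrightarrow> \<iota> y < N"
  defines "C \<equiv> voronoi (parcs G) N \<iota> r Y"
  shows "contract (induced G (\<Union>(C ` Y))) (C ` Y) \<in> depth_minors r G"
proof -
  note g = pair_graphD[OF G]
  have cen: "y \<in> C y" if "y \<in> Y" for y
    unfolding C_def by (intro voronoi_centre \<iota> that)
  have dis: "C y \<inter> C z = {}" if "y \<in> Y" "z \<in> Y" "y \<noteq> z" for y z
    unfolding C_def by (intro voronoi_disjoint \<iota> that)
  have sub: "C y \<subseteq> pverts G" if "y \<in> Y" for y
    using that Y relpow_in_verts[OF g(6)] unfolding C_def voronoi_def by blast
  let ?U = "\<Union>(C ` Y)"
  have U: "?U \<subseteq> pverts G" using sub by blast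
  have part: "partition_on ?U (C ` Y)"
  proof (rule partition_onI)
    show "disjnt p q" if "p \<in> C ` Y" "q \<in> C ` Y" "p \<noteq> q" for p q
      using that dis unfolding disjnt_def by blast
  qed (use cen in blast)+
  have cell: "\<exists>F. pair_graph F \<and> subgraph (with_proj F) (with_proj (induced G ?U)) \<and> pverts F = C y \<and>
        Digraph_Component.connected (with_proj F) \<and> radius F \<le> ereal (real r)" if y: "y \<in> Y" for y
  proof (intro exI conjI)
    let ?F = "induced G (C y)"
    show pg: "pair_graph ?F" using G sub y by (simp add: pair_graph_induced)
    show "subgraph (with_proj ?F) (with_proj (induced G ?U))"
      using y by (intro subgraph_induced G U) auto
    show "pverts ?F = C y" by (simp add: induced_def)
    have w: "\<exists>i\<le>r. (y, a) \<in> parcs ?F ^^ i" if "a \<in> pverts ?F" for a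
      using that voronoi_walk[of a "parcs G" N \<iota> r Y y] by (simp add: induced_def C_def)
    have yF: "y \<in> pverts ?F" using cen y by (simp add: induced_def)
    show "Digraph_Component.connected (with_proj ?F)"
      by (rule connectedI_centre[OF pg yF]) (meson w)
    show "radius ?F \<le> ereal (real r)"
      by (rule radius_le[OF pair_graphD(6)[OF pg] yF w])
  qed
  show ?thesis
    unfolding depth_minors_def
  proof (intro CollectI exI conjI)
    show "subgraph (with_proj (induced G ?U)) (with_proj G)"
      by (intro subgraph_induced_self G U)
    show "partition_on (pverts (induced G ?U)) (C ` Y)"
      using part by (simp add: induced_def)
  qed (use cell pair_graph_induced[OF G U] in auto)
qed

text \<open>
  The cells of the endpoints of a short walk are adjacent unless a third centre of \<open>Y\<close> is close to
  the walk.
\<close>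

lemma card_voronoi_pairs_le:
  assumes G: "pair_graph G" and Y: "Y \<subseteq> pverts G"
    and b: "\<And>M. M \<in> depth_minors r G \<Longrightarrow> real (card (edges M)) \<le> b * real (card (pverts M))"
    and A: "\<And>u w. (u, w) \<in> A \<Longrightarrow> u \<in> Y \<and> w \<in> Y \<and> u \<noteq> w \<and>
       (\<exists>f n. f 0 = u \<and> f n = w \<and> n \<le> 2 * r + 1 \<and> (\<forall>i<n. (f i, f (Suc i)) \<in> parcs G) \<and>
         (\<forall>i\<le>n. \<forall>y\<in>Y. \<forall>j\<le>r. (y, f i) \<in> parcs G ^^ j \<longrightarrow> y = u \<or> y = w))"
  shows "real (card A) \<le> 2 * b * real (card Y)"
proof -
  note g = pair_graphD[OF G]
  have finY: "finite Y" using Y g(1) finite_subset by blast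
  then obtain \<iota> :: "'a \<Rightarrow> nat" and N where "\<iota> ` Y = {i. i < N}" and inj: "inj_on \<iota> Y"
    using finite_imp_inj_to_nat_seg by metis
  then have lt: "\<And>y. y \<in> Y \<Longrightarrow> \<iota> y < N" by blast
  define C where "C = voronoi (parcs G) N \<iota> r Y"
  let ?U = "\<Union>(C ` Y)"
  define M where "M = contract (induced G ?U) (C ` Y)"
  have M: "M \<in> depth_minors r G"
    unfolding M_def C_def by (intro voronoi_depth_minor G Y inj lt)
  have cen: "y \<in> C y" if "y \<in> Y" for y
    unfolding C_def by (intro voronoi_centre inj lt that)
  have dis: "C y \<inter> C z = {}" if "y \<in> Y" "z \<in> Y" "y \<noteq> z" for y z
    unfolding C_def by (intro voronoi_disjoint inj lt that)
  have injC: "inj_on C Y"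
    using cen dis by (intro inj_onI) blast
  have parcsM: "parcs M = {(X, Z). X \<in> C ` Y \<and> Z \<in> C ` Y \<and> X \<noteq> Z \<and>
      (\<exists>x\<in>X. \<exists>y\<in>Z. (x, y) \<in> parcs (induced G ?U))}"
    by (simp add: M_def contract_def)
  have "(C u, C w) \<in> parcs M" if uwA: "(u, w) \<in> A" for u w
  proof -
    obtain f n where uw: "u \<in> Y" "w \<in> Y" "u \<noteq> w" and f: "f 0 = u" "f n = w" "n \<le> 2 * r + 1"
      "\<And>i. i < n \<Longrightarrow> (f i, f (Suc i)) \<in> parcs G"
      and only: "\<And>i y j. i \<le> n \<Longrightarrow> y \<in> Y \<Longrightarrow> j \<le> r \<Longrightarrow> (y, f i) \<in> parcs G ^^ j \<Longrightarrow> y = u \<or> y = w"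
      using A[OF uwA] by blast
    have from_u: "(u, f i) \<in> parcs G ^^ i" if "i \<le> n" for i
      using that f(1,4) by (auto simp: relpow_fun_conv intro!: exI[of _ f])
    have from_w: "(w, f i) \<in> parcs G ^^ (n - i)" if "i \<le> n" for i
    proof -
      have "(f (n - j), f (n - Suc j)) \<in> parcs G" if "j < n - i" for j
        using symD[OF g(3) f(4)[of "n - Suc j"]] that by (simp add: Suc_diff_Suc)
      then show ?thesis using f(2) that
        by (auto simp: relpow_fun_conv intro!: exI[of _ "\<lambda>j. f (n - j)"])
    qed
    \<comment> \<open>Because \<open>n \<le> 2 * r + 1\<close>, each vertex of the walk is within
      \<open>r\<close> steps of one of its ends.\<close>
    have "f i \<in> C u \<union> C w" if i: "i \<le> n" for i
    proof (cases "i \<le> r")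
      case True
      then show ?thesis unfolding C_def using only i
        by (intro voronoi_cover[OF uw(1) from_u]) (auto simp: lt)
    next
      case False
      then have "n - i \<le> r" using f(3) by simp
      then show ?thesis unfolding C_def using only i
        by (intro voronoi_cover[OF uw(2) from_w]) (auto simp: lt)
    qed
    then obtain i where i: "i < n" "f i \<in> C u" "f (Suc i) \<in> C w"
      using path_crossing[of f "C u" n "C w"] cen dis uw f(1,2) by blast
    then have "(f i, f (Suc i)) \<in> parcs (induced G ?U)"
      using f(4) uw by (auto simp: induced_def)
    moreover have "C u \<noteq> C w" using injC uw by (auto dest: inj_onD)
    ultimately show ?thesis unfolding parcsM using uw i by blast
  qed
  moreover have "finite (parcs M)"
    by (rule finite_subset[of _ "C ` Y \<times> C ` Y"]) (use finY in \<open>auto simp: parcsM\<close>)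
  \<comment> \<open>\<open>A\<close> consists of ordered pairs, so it injects into the arcs of the
    minor; passing to edges gives the factor 2.\<close>
  moreover have "inj_on (\<lambda>(u, w). (C u, C w)) A"
    using injC A by (auto simp: inj_on_def)
  ultimately have "card A \<le> card (parcs M)"
    by (intro card_inj_on_le[of "\<lambda>(u, w). (C u, C w)"]) auto
  also have "card (parcs M) = 2 * card (edges M)"
  proof (rule card_arcs_eq)
    have "sym (parcs (induced G ?U))" using g(3) by (auto simp: induced_def sym_def)
    then show "sym (parcs M)" unfolding parcsM by (fastforce simp: sym_def)
    show "irrefl (parcs M)" by (auto simp: parcsM irrefl_def)
  qed fact
  finally have "real (card A) \<le> 2 * real (card (edges M))" by simp
  also have "\<dots> \<le> 2 * (b * real (card (pverts M)))" using b[OF M] by simp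
  also have "card (pverts M) = card Y"
    using card_image[OF injC] by (simp add: M_def contract_def)
  finally show ?thesis by simp
qed

section \<open>Sparsity of powers\<close>

text \<open>
  The subset \<open>Y\<close> of \<open>X\<close> has the probability of being drawn if each element of \<open>X\<close> is chosen
  independently with probability \<open>p\<close>.
\<close>

definition subset_prob :: "real \<Rightarrow> 'a set \<Rightarrow> 'a set \<Rightarrow> real" where
  "subset_prob p X Y = p ^ card Y * (1 - p) ^ card (X - Y)"

text \<open>Expansion of the product of \<open>p + (1 - p)\<close> over the elements of
  \<open>X\<close>.\<close>

lemma sum_subset_prob:
  assumes "finite X"
  shows "(\<Sum>Y\<in>Pow X. subset_prob p X Y) = 1"
  using prod_add[OF assms, of "\<lambda>_. p" "\<lambda>_. 1 - p"] by (simp add: subset_prob_def)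

text \<open>The elements of \<open>A\<close> and of \<open>Z\<close> are decided, with factors
  \<open>p\<close> and \<open>1 - p\<close>; the choices on the rest of \<open>X\<close> sum to
  1.\<close>

lemma subset_prob_constrained:
  assumes "finite X" "A \<subseteq> X" "Z \<subseteq> X" "A \<inter> Z = {}"
  shows "(\<Sum>Y | Y \<subseteq> X \<and> A \<subseteq> Y \<and> Y \<inter> Z = {}. subset_prob p X Y) = p ^ card A * (1 - p) ^ card Z"
proof -
  let ?R = "X - A - Z"
  have "(\<Sum>Y | Y \<subseteq> X \<and> A \<subseteq> Y \<and> Y \<inter> Z = {}. subset_prob p X Y)
      = (\<Sum>Y\<in>Pow ?R. subset_prob p X (A \<union> Y))"
    by (rule sum.reindex_bij_witness[of _ "\<lambda>Y. A \<union> Y" "\<lambda>Y. Y - A"])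
      (use assms in \<open>auto simp: Un_absorb1\<close>)
  also have "\<dots> = (\<Sum>Y\<in>Pow ?R. p ^ card A * (1 - p) ^ card Z * subset_prob p ?R Y)"
  proof (rule sum.cong[OF refl])
    fix Y assume Y: "Y \<in> Pow ?R"
    then have fin: "finite Y" "finite A" "finite Z"
      using assms by (auto intro: finite_subset)
    have "card (A \<union> Y) = card A + card Y" using Y fin by (intro card_Un_disjoint) auto
    moreover have "X - (A \<union> Y) = Z \<union> (?R - Y)" using Y assms by auto
    moreover have "card (Z \<union> (?R - Y)) = card Z + card (?R - Y)"
      using fin assms by (intro card_Un_disjoint) auto
    ultimately show "subset_prob p X (A \<union> Y) = p ^ card A * (1 - p) ^ card Z * subset_prob p ?R Y"
      by (simp add: subset_prob_def power_add)
  qed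
  also have "\<dots> = p ^ card A * (1 - p) ^ card Z"
    using sum_subset_prob[of ?R p] assms(1) by (simp flip: sum_distrib_left)
  finally show ?thesis .
qed

text \<open>Double counting: a pair survives in a random \<open>Y\<close> if both ends are drawn and
  none of its obstacles \<open>Z u w\<close> is. The expected number of survivors is compared with
  \<open>B\<close> times the expected size of \<open>Y\<close>.\<close>

lemma random_subset_bound:
  fixes B :: real and Z :: "'a \<Rightarrow> 'a \<Rightarrow> 'a set"
  assumes X: "finite X" and k: "k \<ge> 1" and A: "A \<subseteq> X \<times> X" "irrefl A"
    and Z: "\<And>u w. (u, w) \<in> A \<Longrightarrow> Z u w \<subseteq> X - {u, w} \<and> card (Z u w) \<le> n * k"
    and B: "\<And>Y. Y \<subseteq> X \<Longrightarrow>
      real (card {(u, w) \<in> A. u \<in> Y \<and> w \<in> Y \<and> Y \<inter> Z u w = {}}) \<le> B * real (card Y)"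
  shows "real (card A) \<le> B * 2 ^ n * (2 * real k) * real (card X)"
proof -
  \<comment> \<open>With \<open>p * k = 1 / 2\<close>, the Bernoulli inequality gives probability at
    least 1/2 for avoiding \<open>k\<close> obstacles, hence \<open>(1 / 2) ^ n\<close> for
    \<open>n * k\<close> of them.\<close>
  define p :: real where "p = 1 / (2 * real k)"
  have p: "0 < p" "p \<le> 1 / 2" using k by (auto simp: p_def field_simps)
  have finA: "finite A" using A(1) X by (auto intro: finite_subset)
  have prob_nonneg: "0 \<le> subset_prob p X Y" for Y using p by (simp add: subset_prob_def)
  let ?good = "\<lambda>Y (u, w). u \<in> Y \<and> w \<in> Y \<and> Y \<inter> Z u w = {}"
  have survive: "(1 / 2) ^ n \<le> (1 - p) ^ (n * k)"
  proof -
    have "1 / 2 = 1 + real k * (- p)" using k by (simp add: p_def)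
    also have "\<dots> \<le> (1 + - p) ^ k" by (rule Bernoulli_inequality) (use p in simp)
    finally have "(1 / 2) ^ n \<le> ((1 - p) ^ k) ^ n" by (intro power_mono) auto
    then show ?thesis by (simp add: power_mult mult.commute flip: power_mult)
  qed
  have "real (card A) * (p\<^sup>2 * (1 / 2) ^ n) = (\<Sum>a\<in>A. p\<^sup>2 * (1 / 2) ^ n)" by simp
  also have "\<dots> \<le> (\<Sum>a\<in>A. \<Sum>Y\<in>Pow X. if ?good Y a then subset_prob p X Y else 0)"
  proof (rule sum_mono)
    fix a assume a: "a \<in> A"
    obtain u w where uw: "a = (u, w)" by fastforce
    then have ne: "u \<noteq> w" "u \<in> X" "w \<in> X" using a A by (auto simp: irrefl_def)
    have "(\<Sum>Y\<in>Pow X. if ?good Y a then subset_prob p X Y else 0)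
        = (\<Sum>Y | Y \<subseteq> X \<and> {u, w} \<subseteq> Y \<and> Y \<inter> Z u w = {}. subset_prob p X Y)"
      using X uw by (subst sum.inter_filter[symmetric]) (auto intro!: sum.cong)
    also have "\<dots> = p\<^sup>2 * (1 - p) ^ card (Z u w)"
      using Z[of u w] a uw ne X by (subst subset_prob_constrained) (auto simp: power2_eq_square)
    also have "\<dots> \<ge> p\<^sup>2 * (1 - p) ^ (n * k)"
      using Z[of u w] a uw p by (intro mult_left_mono power_decreasing) auto
    moreover have "p\<^sup>2 * (1 / 2) ^ n \<le> p\<^sup>2 * (1 - p) ^ (n * k)"
      using survive by (intro mult_left_mono) auto
    ultimately show "p\<^sup>2 * (1 / 2) ^ n \<le> (\<Sum>Y\<in>Pow X. if ?good Y a then subset_prob p X Y else 0)"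
      by linarith
  qed
  \<comment> \<open>Exchange of summation: now each \<open>Y\<close> counts its surviving
    pairs.\<close>
  also have "\<dots> = (\<Sum>Y\<in>Pow X. subset_prob p X Y * real (card {a \<in> A. ?good Y a}))"
    using finA by (subst sum.swap) (simp add: sum.If_cases Int_def mult.commute)
  also have "\<dots> \<le> (\<Sum>Y\<in>Pow X. subset_prob p X Y * (B * real (card Y)))"
  proof (intro sum_mono mult_left_mono prob_nonneg)
    fix Y assume "Y \<in> Pow X"
    then show "real (card {a \<in> A. ?good Y a}) \<le> B * real (card Y)"
      using B[of Y] by (simp add: case_prod_unfold)
  qed
  also have "\<dots> = B * (\<Sum>Y\<in>Pow X. \<Sum>x\<in>X. if x \<in> Y then subset_prob p X Y else 0)"
  proof -
    have "(\<Sum>x\<in>X. if x \<in> Y then subset_prob p X Y else 0) = subset_prob p X Y * real (card Y)"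
      if "Y \<in> Pow X" for Y
    proof -
      have "X \<inter> Y = Y" using that by auto
      then show ?thesis using X by (simp add: sum.If_cases)
    qed
    then show ?thesis by (simp add: sum_distrib_left mult.left_commute)
  qed
  also have "\<dots> = B * (\<Sum>x\<in>X. \<Sum>Y | Y \<subseteq> X \<and> {x} \<subseteq> Y \<and> Y \<inter> {} = {}. subset_prob p X Y)"
  proof -
    have "(\<Sum>Y\<in>Pow X. if x \<in> Y then subset_prob p X Y else 0)
        = (\<Sum>Y | Y \<subseteq> X \<and> {x} \<subseteq> Y \<and> Y \<inter> {} = {}. subset_prob p X Y)" for x
      using X by (subst sum.inter_filter[symmetric]) (auto intro!: sum.cong)
    then show ?thesis by (subst sum.swap) simp
  qed
  also have "\<dots> = B * (\<Sum>x\<in>X. p)"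
    using X by (subst sum.cong[OF refl subset_prob_constrained]) auto
  finally have "real (card A) * (p\<^sup>2 * (1 / 2) ^ n) \<le> B * (real (card X) * p)" by simp
  then have "real (card A) * p\<^sup>2 \<le> B * (real (card X) * p) * 2 ^ n"
    by (simp add: field_simps)
  \<comment> \<open>One factor \<open>p\<close> cancels; the other becomes the factor
    \<open>2 * k\<close>.\<close>
  then have "(real (card A) * p) * p \<le> (B * real (card X) * 2 ^ n) * p"
    by (simp add: power2_eq_square mult_ac)
  then have "real (card A) * p \<le> B * real (card X) * 2 ^ n"
    using p(1) by simp
  then show ?thesis using k by (simp add: p_def field_simps)
qed

section \<open>Induced subgraphs of powers through walks in the base graph\<close>

lemma relpow_sym:
  assumes "sym E" "(u, v) \<in> E ^^ i"
  shows "(v, u) \<in> E ^^ i"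
  using assms(2)
proof (induction i arbitrary: v)
  case (Suc i)
  then obtain x where "(u, x) \<in> E ^^ i" "(x, v) \<in> E" by auto
  then show ?case using Suc.IH assms(1) by (meson relpow_Suc_I2 symD)
qed simp

text \<open>Used in place of the definition of the class: distances become walks in
  \<open>G\<close>, and since walks can be reversed, \<open>H\<close> is itself a
  \<open>pair_graph\<close>.\<close>

lemma pair_graph_induced_closure_power:
  assumes "\<forall>G\<in>C. pair_graph G" "H \<in> induced_closure (class_power C d)"
  obtains G where "G \<in> C" "pair_graph G" "pair_graph H" "pverts H \<subseteq> pverts G"
    "parcs H = {(u, v). u \<in> pverts H \<and> v \<in> pverts H \<and> u \<noteq> v \<and> (\<exists>i\<le>d. (u, v) \<in> parcs G ^^ i)}"
proof -
  obtain G where G: "G \<in> C" "pair_graph G"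
    and ind: "induced_subgraph (with_proj H) (with_proj (graph_power G d))"
    using assms by (auto simp: induced_closure_def class_power_def)
  note g = pair_graphD[OF G(2)]
  have sub: "pverts H \<subseteq> pverts G"
    using ind by (auto simp: induced_subgraph_def subgraph_def graph_power_def)
  have "parcs H = {e \<in> parcs (graph_power G d). fst e \<in> pverts H \<and> snd e \<in> pverts H}"
    using ind by (auto simp: induced_subgraph_def)
  then have arcs: "parcs H =
      {(u, v). u \<in> pverts H \<and> v \<in> pverts H \<and> u \<noteq> v \<and> (\<exists>i\<le>d. (u, v) \<in> parcs G ^^ i)}"
    using sub by (auto simp: graph_power_def distance_le_iff[OF g(6)] subset_iff)
  have "pair_graph H"
    using g(1) sub relpow_sym[OF g(3)]
    by (intro pair_graphI) (auto simp: arcs sym_def irrefl_def intro: finite_subset)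
  then show ?thesis using that G sub arcs by blast
qed

text \<open>The least number is attained once some number is admissible; an injective numbering of
  the vertices provides one, as there are no loops.\<close>

lemma optimal_coloring:
  assumes "pair_graph H"
  obtains f where "proper_coloring H f" "f ` pverts H \<subseteq> {..<chromatic_number H}"
proof -
  note h = pair_graphD[OF assms]
  obtain f :: "'a \<Rightarrow> nat" and n where "f ` pverts H = {i. i < n}" "inj_on f (pverts H)"
    using finite_imp_inj_to_nat_seg[OF h(1)] by metis
  moreover from this have "proper_coloring H f"
    using h(4,5) by (fastforce simp: proper_coloring_def irrefl_def inj_on_def)
  ultimately have "\<exists>f. proper_coloring H f \<and> f ` pverts H \<subseteq> {..<n}" by auto
  then have "\<exists>f. proper_coloring H f \<and> f ` pverts H \<subseteq> {..<chromatic_number H}"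
    unfolding chromatic_number_def by (rule LeastI)
  then show ?thesis using that by blast
qed

text \<open>\<open>random_subset_bound\<close> is applied to the arcs inside \<open>X\<close>, the
  bound for each \<open>Y\<close> coming from the Voronoi minor. The constant depends on
  \<open>C\<close> and \<open>d\<close> only.\<close>

lemma induced_power_sparse:
  assumes C: "\<forall>G\<in>C. pair_graph G" and "bounded_expansion C"
  obtains c :: real where "c \<ge> 0"
    "\<And>H X. H \<in> induced_closure (class_power C d) \<Longrightarrow> X \<subseteq> pverts H \<Longrightarrow>
      real (card (parcs H \<inter> X \<times> X)) \<le> c * real (chromatic_number H) * real (card X)"
proof -
  define r where "r = d div 2"
  obtain b0 where b0: "\<And>G M. G \<in> C \<Longrightarrow> M \<in> depth_minors r G \<Longrightarrow>
      real (card (edges M)) \<le> b0 * real (card (pverts M))"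
    using assms(2) unfolding bounded_expansion_def by meson
  \<comment> \<open>The maximum with 0 makes \<open>c\<close> nonnegative.\<close>
  define b where "b = max b0 0"
  have "b0 * real n \<le> b * real n" for n by (intro mult_right_mono) (auto simp: b_def)
  then have b: "\<And>G M. G \<in> C \<Longrightarrow> M \<in> depth_minors r G \<Longrightarrow>
      real (card (edges M)) \<le> b * real (card (pverts M))"
    using b0 order_trans by blast
  \<comment> \<open>\<open>2 * b\<close> bounds the ordered pairs per vertex of \<open>Y\<close>,
    \<open>2 ^ (d + 1)\<close> pays for the at most \<open>d + 1\<close> balls along a walk, and the
    last 2 comes from the probability \<open>1 / (2 * k)\<close>.\<close>
  define c where "c = 2 * b * 2 ^ (d + 1) * 2"
  have "real (card (parcs H \<inter> X \<times> X)) \<le> c * real (chromatic_number H) * real (card X)"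
    if H: "H \<in> induced_closure (class_power C d)" and X: "X \<subseteq> pverts H" for H X
  proof (cases "pverts H = {}")
    case True
    then show ?thesis using X by simp
  next
    case False
    obtain G where G: "G \<in> C" "pair_graph G" "pair_graph H" "pverts H \<subseteq> pverts G"
      and arcs: "parcs H =
        {(u, v). u \<in> pverts H \<and> v \<in> pverts H \<and> u \<noteq> v \<and> (\<exists>i\<le>d. (u, v) \<in> parcs G ^^ i)}"
      using pair_graph_induced_closure_power[OF C H] by blast
    note g = pair_graphD[OF G(2)] and h = pair_graphD[OF G(3)]
    define k where "k = chromatic_number H"
    obtain f where f: "proper_coloring H f" "f ` pverts H \<subseteq> {..<k}"
      using optimal_coloring[OF G(3)] unfolding k_def by blast
    have k: "k \<ge> 1" using f(2) False by (cases k) auto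
    define ball where "ball v = {x \<in> X. \<exists>j\<le>r. (x, v) \<in> parcs G ^^ j}" for v
    have finX: "finite X" using X h(1) finite_subset by blast
    then have fin_ball: "finite (ball v)" for v by (simp add: ball_def)
    have card_ball: "card (ball v) \<le> k" for v
    proof -
      \<comment> \<open>Vertices of a ball are joined through \<open>v\<close> by walks of length at
        most \<open>2 * r \<le> d\<close>, so they form a clique of \<open>H\<close> and get
        distinct colors.\<close>
      have "inj_on f (ball v)"
      proof (rule inj_onI, rule ccontr)
        fix x y assume xy: "x \<in> ball v" "y \<in> ball v" "f x = f y" "x \<noteq> y"
        then obtain i j where "i \<le> r" "j \<le> r" "(x, v) \<in> parcs G ^^ i" "(v, y) \<in> parcs G ^^ j"
          using relpow_sym[OF g(3)] by (auto simp: ball_def)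
        then have "(x, y) \<in> parcs G ^^ (i + j)" "i + j \<le> d"
          by (auto simp: relpow_add r_def)
        moreover have "x \<in> pverts H" "y \<in> pverts H" using xy X by (auto simp: ball_def)
        ultimately have "(x, y) \<in> parcs H" using xy(4) unfolding arcs by blast
        then show False using f(1) xy(3) by (auto simp: proper_coloring_def)
      qed
      moreover have "f ` ball v \<subseteq> {..<k}" using f(2) X by (auto simp: ball_def)
      ultimately show ?thesis using card_inj_on_le[of f "ball v" "{..<k}"] by simp
    qed
    let ?walk = "\<lambda>u w g n. g 0 = u \<and> g n = w \<and> n \<le> d \<and> (\<forall>i<n. (g i, g (Suc i)) \<in> parcs G)"
    have "\<exists>g n. ?walk u w g n" if "(u, w) \<in> parcs H" for u w
      using that unfolding arcs by (auto simp: relpow_fun_conv)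
    then obtain g n where walk: "\<And>u w. (u, w) \<in> parcs H \<Longrightarrow> ?walk u w (g u w) (n u w)"
      by metis
    \<comment> \<open>The obstacles of a pair: all other vertices of \<open>X\<close> close to the
      chosen walk from \<open>u\<close> to \<open>w\<close>.\<close>
    define Z where "Z u w = (\<Union>i\<le>n u w. ball (g u w i)) - {u, w}" for u w
    have "real (card (parcs H \<inter> X \<times> X)) \<le> 2 * b * 2 ^ (d + 1) * (2 * real k) * real (card X)"
    proof (rule random_subset_bound[OF finX k])
      show "irrefl (parcs H \<inter> X \<times> X)" using h(4) by (auto simp: irrefl_def)
      show "Z u w \<subseteq> X - {u, w} \<and> card (Z u w) \<le> (d + 1) * k" if "(u, w) \<in> parcs H \<inter> X \<times> X" for u w
      proof
        show "Z u w \<subseteq> X - {u, w}" by (auto simp: Z_def ball_def)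
        have "card (Z u w) \<le> card (\<Union>i\<le>n u w. ball (g u w i))"
          unfolding Z_def using fin_ball by (intro card_mono) auto
        also have "\<dots> \<le> (\<Sum>i\<le>n u w. card (ball (g u w i)))" by (intro card_UN_le) simp
        also have "\<dots> \<le> (\<Sum>i\<le>n u w. k)" by (intro sum_mono card_ball)
        also have "\<dots> \<le> (d + 1) * k" using walk[of u w] that by auto
        finally show "card (Z u w) \<le> (d + 1) * k" .
      qed
      show "real (card {(u, w) \<in> parcs H \<inter> X \<times> X. u \<in> Y \<and> w \<in> Y \<and> Y \<inter> Z u w = {}})
          \<le> 2 * b * real (card Y)" if Y: "Y \<subseteq> X" for Y
      proof (rule card_voronoi_pairs_le[OF G(2)])
        show "Y \<subseteq> pverts G" using Y X G(4) by blast
        fix u w assume "(u, w) \<in> {(u, w) \<in> parcs H \<inter> X \<times> X. u \<in> Y \<and> w \<in> Y \<and> Y \<inter> Z u w = {}}"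
        then have uw: "(u, w) \<in> parcs H" "u \<in> Y" "w \<in> Y" "Y \<inter> Z u w = {}" by auto
        then have "u \<noteq> w" using h(4) by (auto simp: irrefl_def)
        \<comment> \<open>The \<open>+ 1\<close> accounts for odd \<open>d\<close>.\<close>
        moreover have "n u w \<le> 2 * r + 1" using walk[OF uw(1)] by (auto simp: r_def)
        moreover have "\<forall>i\<le>n u w. \<forall>y\<in>Y. \<forall>j\<le>r. (y, g u w i) \<in> parcs G ^^ j \<longrightarrow> y = u \<or> y = w"
          using uw(4) Y unfolding Z_def ball_def by blast
        ultimately show "u \<in> Y \<and> w \<in> Y \<and> u \<noteq> w \<and>
          (\<exists>f n. f 0 = u \<and> f n = w \<and> n \<le> 2 * r + 1 \<and> (\<forall>i<n. (f i, f (Suc i)) \<in> parcs G) \<and>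
            (\<forall>i\<le>n. \<forall>y\<in>Y. \<forall>j\<le>r. (y, f i) \<in> parcs G ^^ j \<longrightarrow> y = u \<or> y = w))"
          using walk[OF uw(1)] uw(2,3) by blast
      qed (use b G(1) in blast)
    qed auto
    then show ?thesis by (simp add: c_def k_def mult_ac)
  qed
  moreover have "c \<ge> 0" by (simp add: c_def b_def)
  ultimately show ?thesis using that by blast
qed

section \<open>Program verification\<close>

text \<open>
  Memory holding the input and the output below address \<open>L\<close> (array 8), and eight interleaved work
  arrays above: entry \<open>i\<close> of array \<open>j < 8\<close> is at address \<open>8 * i + L + j\<close>.
\<close>

definition mem_of :: "nat \<Rightarrow> (nat \<Rightarrow> nat \<Rightarrow> nat) \<Rightarrow> nat \<Rightarrow> nat" where
  "mem_of L A x = (if x < L then A 8 x else A ((x - L) mod 8) ((x - L) div 8))"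

lemma mem_of_low [simp]: "x < L \<Longrightarrow> mem_of L A x = A 8 x"
  by (simp add: mem_of_def)

lemma mem_of_high: "j < 8 \<Longrightarrow> mem_of L A (8 * i + L + j) = A j i"
  by (simp add: mem_of_def)

lemma mem_of_upd_low: "x < L \<Longrightarrow> (mem_of L A)(x := v) = mem_of L (A(8 := (A 8)(x := v)))"
  by (rule ext) (auto simp: mem_of_def)

lemma mem_of_upd_high:
  assumes "j < 8"
  shows "(mem_of L A)(8 * i + L + j := v) = mem_of L (A(j := (A j)(i := v)))"
proof
  fix x
  show "((mem_of L A)(8 * i + L + j := v)) x = mem_of L (A(j := (A j)(i := v))) x"
  proof (cases "x = 8 * i + L + j")
    case True
    then show ?thesis using assms by (simp add: mem_of_def)
  next
    case False
    then have "x < L \<or> (x - L) mod 8 \<noteq> j \<or> (x - L) div 8 \<noteq> i"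
      using div_mult_mod_eq[of "x - L" 8] by linarith
    then show ?thesis using False assms by (auto simp: mem_of_def)
  qed
qed

text \<open>Total correctness over arrays instead of addresses. The postcondition sees the number of
  steps, so time bounds are proved together with results.\<close>

definition wp ::
  "nat \<Rightarrow> nat \<Rightarrow> ram \<Rightarrow> (nat \<Rightarrow> nat) \<Rightarrow> (nat \<Rightarrow> nat \<Rightarrow> nat) \<Rightarrow>
     (nat \<Rightarrow> (nat \<Rightarrow> nat) \<Rightarrow> (nat \<Rightarrow> nat \<Rightarrow> nat) \<Rightarrow> bool) \<Rightarrow> bool" where
  "wp W L p R A Q \<longleftrightarrow> (\<exists>t R' A'. exec W p (R, mem_of L A) t (R', mem_of L A') \<and> Q t R' A')"

lemma wp_Const: "k \<le> W \<Longrightarrow> Q 1 (R(r := k)) A \<Longrightarrow> wp W L (Const r k) R A Q"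
  unfolding wp_def by (blast intro: exec.Const)

lemma wp_Add: "R a + R b \<le> W \<Longrightarrow> Q 1 (R(r := R a + R b)) A \<Longrightarrow> wp W L (Add r a b) R A Q"
  unfolding wp_def by (blast intro: exec.Add)

lemma wp_Sub: "Q 1 (R(r := R a - R b)) A \<Longrightarrow> wp W L (Sub r a b) R A Q"
  unfolding wp_def by (blast intro: exec.Sub)

lemma wp_Load: "R a < L \<Longrightarrow> Q 1 (R(r := A 8 (R a))) A \<Longrightarrow> wp W L (Load r a) R A Q"
  unfolding wp_def using exec.Load[of W r a R "mem_of L A"] by (metis mem_of_low)

lemma wp_Store:
  "R a < L \<Longrightarrow> Q 1 R (A(8 := (A 8)(R a := R b))) \<Longrightarrow> wp W L (Store a b) R A Q"
  unfolding wp_def using exec.Store[of W a b R "mem_of L A"] by (metis mem_of_upd_low)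

lemma wp_Seq:
  "wp W L p R A (\<lambda>t R A. wp W L q R A (\<lambda>u. Q (t + u))) \<Longrightarrow> wp W L (Seq p q) R A Q"
  unfolding wp_def by (blast intro: exec.Seq)

lemma wp_IfLess:
  assumes "R a < R b \<Longrightarrow> wp W L p R A (\<lambda>t. Q (Suc t))"
    and "\<not> R a < R b \<Longrightarrow> wp W L q R A (\<lambda>t. Q (Suc t))"
  shows "wp W L (IfLess a b p q) R A Q"
proof (cases "R a < R b")
  case True
  then show ?thesis using assms(1) unfolding wp_def by (blast intro: exec.IfTrue)
next
  case False
  then show ?thesis using assms(2) unfolding wp_def by (blast intro: exec.IfFalse)
qed

lemma wp_mono:
  "wp W L p R A Q \<Longrightarrow> (\<And>t R' A'. Q t R' A' \<Longrightarrow> Q' t R' A') \<Longrightarrow> wp W L p R A Q'"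
  unfolding wp_def by blast

text \<open>\<Phi> is a potential: an iteration with its test costs at most the amount by which
  \<Phi> falls. This gives termination and, as \<Phi> may depend on the whole state, amortized time;
  the extra step is the last, failing test.\<close>

lemma wp_WhileLess:
  assumes "Inv R A"
    and step: "\<And>R A. Inv R A \<Longrightarrow> R a < R b \<Longrightarrow>
      wp W L p R A (\<lambda>t R' A'. Inv R' A' \<and> Suc t + \<Phi> R' A' \<le> \<Phi> R A)"
    and post: "\<And>t R' A'. Inv R' A' \<Longrightarrow> \<not> R' a < R' b \<Longrightarrow> t + \<Phi> R' A' \<le> Suc (\<Phi> R A) \<Longrightarrow> Q t R' A'"
  shows "wp W L (WhileLess a b p) R A Q"
proof -
  have "\<exists>t R' A'. exec W (WhileLess a b p) (R, mem_of L A) t (R', mem_of L A') \<and>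
      Inv R' A' \<and> \<not> R' a < R' b \<and> t + \<Phi> R' A' \<le> Suc (\<Phi> R A)"
    using \<open>Inv R A\<close>
  proof (induction "\<Phi> R A" arbitrary: R A rule: less_induct)
    case less
    show ?case
    proof (cases "R a < R b")
      case True
      then obtain t R1 A1 where 1: "exec W p (R, mem_of L A) t (R1, mem_of L A1)" "Inv R1 A1"
        "Suc t + \<Phi> R1 A1 \<le> \<Phi> R A"
        using step[OF less.prems] unfolding wp_def by blast
      moreover from 1 obtain u R' A' where
        "exec W (WhileLess a b p) (R1, mem_of L A1) u (R', mem_of L A')"
        "Inv R' A'" "\<not> R' a < R' b" "u + \<Phi> R' A' \<le> Suc (\<Phi> R1 A1)"
        using less.hyps[of R1 A1] by auto
      moreover from calculation have
        "exec W (WhileLess a b p) (R, mem_of L A) (Suc (t + u)) (R', mem_of L A')"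
        using True by (blast intro: exec.WhileTrue)
      ultimately show ?thesis
        by (intro exI[of _ "Suc (t + u)"] exI[of _ R'] exI[of _ A']) auto
    next
      case False
      then show ?thesis using less.prems exec.WhileFalse[of R a b W p "mem_of L A"]
        by (intro exI[of _ 1] exI[of _ R] exI[of _ A]) auto
    qed
  qed
  then show ?thesis using post unfolding wp_def by blast
qed

section \<open>Access to the interleaved work arrays\<close>

definition addr :: "nat \<Rightarrow> nat \<Rightarrow> ram" where
  "addr j a = Seq (Add 2 a a) (Seq (Add 2 2 2) (Seq (Add 2 2 2) (Seq (Add 2 2 0)
     (Seq (Const 3 j) (Add 2 2 3)))))"

definition get :: "nat \<Rightarrow> nat \<Rightarrow> nat \<Rightarrow> ram" where
  "get r j a = Seq (addr j a) (Load r 2)"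

definition put :: "nat \<Rightarrow> nat \<Rightarrow> nat \<Rightarrow> ram" where
  "put j a b = Seq (addr j a) (Store 2 b)"

text \<open>Three doublings replace the multiplication by 8. The final address bounds every
  intermediate value, so it alone is compared with \<open>W\<close>.\<close>

lemma exec_addr:
  assumes "8 * R a + R 0 + j \<le> W"
  shows "exec W (addr j a) (R, M) 6 (R(2 := 8 * R a + R 0 + j, 3 := j), M)"
proof -
  let ?x = "R a + R a"
  let ?R1 = "R(2 := ?x)"
  let ?R2 = "R(2 := ?x + ?x)"
  let ?R3 = "R(2 := ?x + ?x + (?x + ?x))"
  let ?R4 = "R(2 := ?x + ?x + (?x + ?x) + R 0)"
  let ?R5 = "?R4(3 := j)"
  have 1: "exec W (Add 2 a a) (R, M) 1 (?R1, M)"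
    by (rule exec.Add) (use assms in simp)
  have 2: "exec W (Add 2 2 2) (?R1, M) 1 (?R2, M)"
    using exec.Add[of ?R1 2 2 W 2 M] assms by simp
  have 3: "exec W (Add 2 2 2) (?R2, M) 1 (?R3, M)"
    using exec.Add[of ?R2 2 2 W 2 M] assms by simp
  have 4: "exec W (Add 2 2 0) (?R3, M) 1 (?R4, M)"
    using exec.Add[of ?R3 2 0 W 2 M] assms by simp
  have 5: "exec W (Const 3 j) (?R4, M) 1 (?R5, M)"
    by (rule exec.Const) (use assms in simp)
  have "?R5(2 := ?R5 2 + ?R5 3) = R(2 := 8 * R a + R 0 + j, 3 := j)" by auto
  then have 6: "exec W (Add 2 2 3) (?R5, M) 1 (R(2 := 8 * R a + R 0 + j, 3 := j), M)"
    using exec.Add[of ?R5 2 3 W 2 M] assms by simp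
  show ?thesis
    using exec.Seq[OF 1 exec.Seq[OF 2 exec.Seq[OF 3 exec.Seq[OF 4 exec.Seq[OF 5 6]]]]]
    by (simp add: addr_def numeral_eq_Suc del: One_nat_def)
qed

lemma wp_get:
  assumes "R 0 = L" "j < 8" "8 * R a + L + j \<le> W"
    and "Q 7 (R(2 := 8 * R a + L + j, 3 := j, r := A j (R a))) A"
  shows "wp W L (get r j a) R A Q"
proof -
  let ?R = "R(2 := 8 * R a + L + j, 3 := j)"
  have "exec W (Load r 2) (?R, mem_of L A) 1 (?R(r := A j (R a)), mem_of L A)"
    using exec.Load[of W r 2 ?R "mem_of L A"] mem_of_high[OF assms(2), of L A "R a"]
    by (simp add: add_ac)
  with exec_addr[of R a j W "mem_of L A"] assms(1,3)
  have "exec W (get r j a) (R, mem_of L A) (6 + 1) (?R(r := A j (R a)), mem_of L A)"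
    unfolding get_def by (intro exec.Seq) auto
  then show ?thesis using assms(4) unfolding wp_def by auto
qed

text \<open>Registers 2 and 3 are overwritten by the address computation before the value is stored,
  so the value cannot come from them.\<close>

lemma wp_put:
  assumes "R 0 = L" "j < 8" "8 * R a + L + j \<le> W" "b \<noteq> 2" "b \<noteq> 3"
    and "Q 7 (R(2 := 8 * R a + L + j, 3 := j)) (A(j := (A j)(R a := R b)))"
  shows "wp W L (put j a b) R A Q"
proof -
  let ?R = "R(2 := 8 * R a + L + j, 3 := j)"
  have "exec W (Store 2 b) (?R, mem_of L A) 1 (?R, mem_of L (A(j := (A j)(R a := R b))))"
    using exec.Store[of W 2 b ?R "mem_of L A"] mem_of_upd_high[OF assms(2), of L A "R a" "R b"]
      assms(4,5) by (simp add: add_ac)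
  with exec_addr[of R a j W "mem_of L A"] assms(1,3)
  have "exec W (put j a b) (R, mem_of L A) (6 + 1) (?R, mem_of L (A(j := (A j)(R a := R b))))"
    unfolding put_def by (intro exec.Seq) auto
  then show ?thesis using assms(6) unfolding wp_def by auto
qed

lemmas wp_rules = wp_Seq wp_Const wp_Add wp_Sub wp_Load wp_Store wp_IfLess wp_get wp_put

section \<open>The coloring program\<close>

notation Seq (infixr ";;" 60)

text \<open>
  Register 0 holds the base address of the work arrays until the output, and registers 2 and 3 are
  scratch registers of \<open>addr\<close>. \<open>rK\<close> counts the vertices that are kept in \<open>scan\<close> and is the stamp of
  the current vertex in \<open>greedy\<close>.
\<close>

abbreviation (input) "rOne \<equiv> 4 :: nat"
abbreviation (input) "rZero \<equiv> 5 :: nat"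
abbreviation (input) "rN \<equiv> 6 :: nat"
abbreviation (input) "rU \<equiv> 7 :: nat"
abbreviation (input) "rPos \<equiv> 8 :: nat"
abbreviation (input) "rEnd \<equiv> 9 :: nat"
abbreviation (input) "rThr \<equiv> 10 :: nat"
abbreviation (input) "rAct \<equiv> 11 :: nat"
abbreviation (input) "rJ \<equiv> 12 :: nat"
abbreviation (input) "rK \<equiv> 13 :: nat"
abbreviation (input) "rV \<equiv> 14 :: nat"
abbreviation (input) "rG \<equiv> 15 :: nat"
abbreviation (input) "rTop \<equiv> 16 :: nat"
abbreviation (input) "rCol \<equiv> 17 :: nat"
abbreviation (input) "rMark \<equiv> 18 :: nat"

abbreviation (input) "aPtr \<equiv> 2 :: nat"
abbreviation (input) "aDeg \<equiv> 3 :: nat"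
abbreviation (input) "aAct \<equiv> 4 :: nat"
abbreviation (input) "aOrd \<equiv> 5 :: nat"
abbreviation (input) "aCol \<equiv> 6 :: nat"
abbreviation (input) "aMark \<equiv> 7 :: nat"

text \<open>\<open>aPtr\<close> records the address of the length entry of a list, not of its first
  neighbour. \<open>rZero\<close> and \<open>rU\<close> rely on registers being initially 0, and
  register 0 already holds the input length, which is the base address.\<close>

definition parse :: ram where
  "parse = Const rOne 1 ;; Load rN rZero ;; Const rPos 1 ;;
     WhileLess rU rN
       (put aPtr rU rPos ;; Load rG rPos ;; put aDeg rU rG ;; put aAct rU rU ;;
        Add rPos rPos rG ;; Add rPos rPos rOne ;; Add rU rU rOne)"

text \<open>The pointer starts at the length entry and is advanced before each access, so the
  entries up to and including \<open>rEnd\<close> are read.\<close>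

definition foreach :: "ram \<Rightarrow> ram" where
  "foreach p = get rPos aPtr rV ;; Load rEnd rPos ;; Add rEnd rEnd rPos ;;
     WhileLess rPos rEnd (Add rPos rPos rOne ;; Load rU rPos ;; p)"

definition decrement_nbrs :: ram where
  "decrement_nbrs = foreach (get rG aDeg rU ;; Sub rG rG rOne ;; put aDeg rU rG)"

text \<open>The list of remaining vertices is compacted in place, \<open>rJ\<close> reading and
  \<open>rK\<close> writing, while removed vertices fill \<open>aOrd\<close> downwards from
  \<open>rTop\<close>.\<close>

definition scan_step :: ram where
  "scan_step = get rV aAct rJ ;; get rG aDeg rV ;;
     IfLess rThr rG
       (put aAct rK rV ;; Add rK rK rOne)
       (Sub rTop rTop rOne ;; put aOrd rTop rV ;; decrement_nbrs) ;;
     Add rJ rJ rOne"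

definition scan :: ram where
  "scan = WhileLess rJ rAct scan_step"

text \<open>Comparing \<open>rAct\<close> with twice \<open>rK\<close> tests without division
  whether more than half survived. The assignment to \<open>rG\<close> gives the other branch the
  same cost.\<close>

definition peel_round :: ram where
  "peel_round = Const rJ 0 ;; Const rK 0 ;; Add rTop rAct rZero ;; scan ;;
     Add rG rK rK ;; IfLess rAct rG (Add rThr rThr rOne) (Const rG 0) ;; Add rAct rK rZero"

definition peel :: ram where
  "peel = Const rThr 0 ;; Add rAct rN rZero ;; WhileLess rZero rAct peel_round"

text \<open>Stamps grow with the position in the order, so \<open>aMark\<close> never has to be
  cleared. Uncolored neighbours have color 0 and mark only that cell, which
  \<open>find_color\<close> skips by starting at 1.\<close>

definition mark_nbrs :: ram where
  "mark_nbrs = foreach (get rG aCol rU ;; put aMark rG rK)"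

definition find_color :: ram where
  "find_color = Const rCol 1 ;; get rMark aMark rCol ;;
     WhileLess rJ rMark (Add rCol rCol rOne ;; get rMark aMark rCol)"

definition greedy_step :: ram where
  "greedy_step = get rV aOrd rJ ;; Add rK rJ rOne ;; mark_nbrs ;; find_color ;;
     put aCol rV rCol ;; Add rJ rJ rOne"

definition greedy :: ram where
  "greedy = Const rJ 0 ;; WhileLess rJ rN greedy_step"

text \<open>The colors overwrite the input, which is no longer read; only afterwards may register 0
  receive the output length.\<close>

definition emit :: ram where
  "emit = Const rU 0 ;; WhileLess rU rN (get rG aCol rU ;; Store rU rG ;; Add rU rU rOne) ;;
     Add 0 rN rZero"

definition color_program :: ram where
  "color_program = parse ;; peel ;; greedy ;; emit"

section \<open>Layout of the input\<close>

lemma concat_nth_offset: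
  assumes "v < length xss" "k < length (xss ! v)"
  shows "(\<Sum>u<v. length (xss ! u)) + k < length (concat xss) \<and>
    concat xss ! ((\<Sum>u<v. length (xss ! u)) + k) = xss ! v ! k"
  using assms
proof (induction xss arbitrary: v)
  case (Cons ys xss)
  show ?case
  proof (cases v)
    case 0
    then show ?thesis using Cons.prems by (simp add: nth_append)
  next
    case (Suc w)
    then have "(\<Sum>u<v. length ((ys # xss) ! u)) = length ys + (\<Sum>u<w. length (xss ! u))"
      by (simp add: sum.lessThan_Suc_shift del: sum.lessThan_Suc)
    then show ?thesis using Cons.IH[of w] Cons.prems Suc by (simp add: nth_append)
  qed
qed simp

text \<open>The graph on vertex numbers. \<open>sparse\<close> counts each edge twice;
  \<open>W_ge\<close> admits every address \<open>8 * i + L + j\<close> with \<open>i < L\<close>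
  and \<open>j < 8\<close>, where \<open>L\<close> is the input length.\<close>

locale adjacency_lists =
  fixes Ns :: "nat list list" and W :: nat and q :: real
  assumes distinct_nbrs: "v < length Ns \<Longrightarrow> distinct (Ns ! v)"
    and nbrs_lt: "v < length Ns \<Longrightarrow> set (Ns ! v) \<subseteq> {..<length Ns}"
    and nbrs_sym: "u < length Ns \<Longrightarrow> v < length Ns \<Longrightarrow> u \<in> set (Ns ! v) \<Longrightarrow> v \<in> set (Ns ! u)"
    and nbrs_irrefl: "v < length Ns \<Longrightarrow> v \<notin> set (Ns ! v)"
    and sparse: "S \<subseteq> {..<length Ns} \<Longrightarrow>
      real (\<Sum>u\<in>S. card (set (Ns ! u) \<inter> S)) \<le> q * real (card S)"
    and q_nonneg: "0 \<le> q"
    and W_ge: "9 * (1 + length Ns + sum_list (map length Ns)) + 8 \<le> W"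
begin

definition "n = length Ns"
definition "nbrs v = set (Ns ! v)"
definition "deg v = length (Ns ! v)"
definition "input = n # concat (map (\<lambda>N. length N # N) Ns)"
definition "L = length input"
definition "pos v = 1 + (\<Sum>u<v. deg u + 1)"

lemma card_nbrs: "v < n \<Longrightarrow> card (nbrs v) = deg v"
  by (simp add: n_def nbrs_def deg_def distinct_card distinct_nbrs)

lemma finite_nbrs [simp]: "finite (nbrs v)"
  by (simp add: nbrs_def)

lemma nbrs_subset: "v < n \<Longrightarrow> nbrs v \<subseteq> {..<n}"
  using nbrs_lt by (simp add: n_def nbrs_def)

lemma nbrs_commute: "u < n \<Longrightarrow> v < n \<Longrightarrow> u \<in> nbrs v \<longleftrightarrow> v \<in> nbrs u"
  using nbrs_sym by (auto simp: n_def nbrs_def)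

lemma not_in_nbrs: "v < n \<Longrightarrow> v \<notin> nbrs v"
  using nbrs_irrefl by (simp add: n_def nbrs_def)

lemma L_eq: "L = 1 + n + sum_list (map length Ns)"
proof -
  have "length (concat (map (\<lambda>N. length N # N) xss)) = length xss + sum_list (map length xss)"
    for xss :: "nat list list"
    by (induction xss) auto
  then show ?thesis by (simp add: L_def input_def n_def)
qed

lemma W_ge_L: "9 * L + 8 \<le> W"
  using W_ge by (simp add: L_eq n_def)

lemma n_less_L: "n < L"
  by (simp add: L_eq)

lemma input_nth:
  assumes "v < n" "k \<le> deg v"
  shows "pos v + k < L" "input ! (pos v + k) = (deg v # Ns ! v) ! k"
proof -
  let ?xss = "map (\<lambda>N. length N # N) Ns"
  have "(\<Sum>u<v. length (?xss ! u)) = (\<Sum>u<v. deg u + 1)"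
    using assms(1) by (intro sum.cong) (auto simp: deg_def n_def)
  moreover have "v < length ?xss" "k < length (?xss ! v)" "?xss ! v = deg v # Ns ! v"
    using assms by (auto simp: n_def deg_def)
  ultimately show "pos v + k < L" "input ! (pos v + k) = (deg v # Ns ! v) ! k"
    using concat_nth_offset[of v ?xss k] by (auto simp: pos_def L_def input_def)
qed

lemma deg_less_n: "v < n \<Longrightarrow> deg v < n"
  using card_mono[of "{..<n} - {v}" "nbrs v"] nbrs_subset not_in_nbrs card_nbrs by fastforce

definition low :: "nat \<Rightarrow> nat" where
  "low i = (if i < L then input ! i else 0)"

text \<open>The facts established by \<open>parse\<close> and preserved until \<open>emit\<close>
  starts to write.\<close>

definition std :: "(nat \<Rightarrow> nat) \<Rightarrow> (nat \<Rightarrow> nat \<Rightarrow> nat) \<Rightarrow> bool" where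
  "std R A \<longleftrightarrow> R 0 = L \<and> R rOne = 1 \<and> R rZero = 0 \<and> R rN = n \<and> A 8 = low \<and>
     (\<forall>v<n. A aPtr v = pos v)"

definition agree :: "nat set \<Rightarrow> (nat \<Rightarrow> nat) \<Rightarrow> (nat \<Rightarrow> nat) \<Rightarrow> bool" where
  "agree S R R' \<longleftrightarrow> (\<forall>r. r \<notin> S \<longrightarrow> R' r = R r)"

lemma wp_parse:
  assumes "R = (\<lambda>r. if r = 0 then L else 0)" "A = (\<lambda>j. if j = 8 then low else (\<lambda>_. 0))"
    and Q: "\<And>t R' A'. std R' A' \<Longrightarrow> (\<forall>v<n. A' aDeg v = deg v \<and> A' aAct v = v) \<Longrightarrow>
      A' aCol = (\<lambda>_. 0) \<Longrightarrow> A' aMark = (\<lambda>_. 0) \<Longrightarrow> t \<le> 4 + 26 * n \<Longrightarrow> Q t R' A'"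
  shows "wp W L parse R A Q"
proof -
  let ?Inv = "\<lambda>R A. R 0 = L \<and> R rOne = 1 \<and> R rZero = 0 \<and> R rN = n \<and> A 8 = low \<and> R rU \<le> n \<and>
    R rPos = pos (R rU) \<and> (\<forall>v<R rU. A aPtr v = pos v \<and> A aDeg v = deg v \<and> A aAct v = v) \<and>
    A aCol = (\<lambda>_. 0) \<and> A aMark = (\<lambda>_. 0)"
  have loop: "wp W L (WhileLess rU rN
       (put aPtr rU rPos ;; Load rG rPos ;; put aDeg rU rG ;; put aAct rU rU ;;
        Add rPos rPos rG ;; Add rPos rPos rOne ;; Add rU rU rOne)) R1 A1 Q1"
    if "?Inv R1 A1" and Q1: "\<And>t R' A'. ?Inv R' A' \<Longrightarrow> R' rU = n \<Longrightarrow> t \<le> Suc (26 * (n - R1 rU)) \<Longrightarrow> Q1 t R' A'"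
    for R1 A1 Q1
  \<comment> \<open>26 steps: three \<open>put\<close> of 7 steps each, four elementary instructions
    and the test.\<close>
  proof (rule wp_WhileLess[where Inv = ?Inv and \<Phi> = "\<lambda>R A. 26 * (n - R rU)"])
    fix R A assume inv: "?Inv R A" and "R rU < R rN"
    then have v: "R rU < n" by simp
    have pos: "pos (R rU) < L" "low (pos (R rU)) = deg (R rU)" "pos (R rU) + deg (R rU) < L"
      using input_nth[OF v, of 0] input_nth(1)[OF v, of "deg (R rU)"] by (auto simp: low_def)
    have "pos (Suc (R rU)) = pos (R rU) + deg (R rU) + 1" by (simp add: pos_def)
    then show "wp W L (put aPtr rU rPos ;; Load rG rPos ;; put aDeg rU rG ;; put aAct rU rU ;;
        Add rPos rPos rG ;; Add rPos rPos rOne ;; Add rU rU rOne) R A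
        (\<lambda>t R' A'. ?Inv R' A' \<and> Suc t + 26 * (n - R' rU) \<le> 26 * (n - R rU))"
      by (intro wp_rules) (use inv v pos W_ge_L n_less_L in \<open>auto simp: less_Suc_eq\<close>)
  qed (use that in auto)
  show ?thesis
    unfolding parse_def
  proof (intro wp_rules loop)
    have "low 0 = n" using n_less_L by (simp add: low_def input_def)
    then show "?Inv (R(rOne := 1, rN := A 8 ((R(rOne := 1)) rZero), rPos := 1)) A"
      using assms(1,2) by (simp add: pos_def)
  qed (use assms W_ge_L n_less_L in \<open>auto simp: std_def\<close>)
qed

text \<open>\<open>J k\<close> describes the arrays after \<open>k\<close> neighbours have been
  treated. The 10 steps are the setup and the last test; the 3 added to \<open>c\<close> are the
  test, the increment and the load.\<close>

lemma wp_foreach: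
  assumes "std R A" "R rV = v" "v < n" "J 0 A"
    and body: "\<And>k R' A'. k < deg v \<Longrightarrow> J k A' \<Longrightarrow> std R' A' \<Longrightarrow>
      agree {2, 3, rU, rPos, rEnd, rG} R R' \<Longrightarrow> R' rU = Ns ! v ! k \<Longrightarrow>
      wp W L p R' A' (\<lambda>t R'' A''. t \<le> c \<and> J (Suc k) A'' \<and> std R'' A'' \<and> agree {2, 3, rG} R' R'')"
    and Q: "\<And>t R' A'. J (deg v) A' \<Longrightarrow> std R' A' \<Longrightarrow> agree {2, 3, rU, rPos, rEnd, rG} R R' \<Longrightarrow>
      t \<le> 10 + (c + 3) * deg v \<Longrightarrow> Q t R' A'"
  shows "wp W L (foreach p) R A Q"
proof -
  let ?S = "{2, 3, rU, rPos, rEnd, rG}"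
  let ?Inv = "\<lambda>R' A'. \<exists>k\<le>deg v. R' rPos = pos v + k \<and> R' rEnd = pos v + deg v \<and> J k A' \<and>
    std R' A' \<and> agree ?S R R'"
  let ?\<Phi> = "\<lambda>R' A' :: nat \<Rightarrow> nat \<Rightarrow> nat. (c + 3) * (R' rEnd - R' rPos)"
  have loop: "wp W L (WhileLess rPos rEnd (Add rPos rPos rOne ;; Load rU rPos ;; p)) R1 A1 Q1"
    if "?Inv R1 A1" and Q1: "\<And>t R' A'. J (deg v) A' \<Longrightarrow> std R' A' \<Longrightarrow> agree ?S R R' \<Longrightarrow>
      t \<le> Suc (?\<Phi> R1 A1) \<Longrightarrow> Q1 t R' A'"
    for R1 A1 Q1
  proof (rule wp_WhileLess[where Inv = ?Inv and \<Phi> = ?\<Phi>, OF that(1)])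
    fix R1 A1 assume "?Inv R1 A1" "R1 rPos < R1 rEnd"
    then obtain k where k: "k < deg v" "R1 rPos = pos v + k" "R1 rEnd = pos v + deg v" "J k A1"
      and std: "std R1 A1" and ag: "agree ?S R R1" by auto
    have rd: "pos v + Suc k < L" "low (pos v + Suc k) = Ns ! v ! k"
      using input_nth[OF \<open>v < n\<close>, of "Suc k"] k(1) by (auto simp: low_def)
    let ?R = "R1(rPos := pos v + Suc k, rU := Ns ! v ! k)"
    have wp_p: "wp W L p ?R A1 (\<lambda>t R'' A''. t \<le> c \<and> J (Suc k) A'' \<and> std R'' A'' \<and> agree {2, 3, rG} ?R R'')"
      by (rule body) (use k std ag in \<open>auto simp: std_def agree_def\<close>)
    have less: "(c + 3) * (deg v - k) = c + 3 + (c + 3) * (deg v - Suc k)"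
      using k(1) by (metis Suc_diff_Suc mult_Suc_right)
    have "wp W L p ?R A1 (\<lambda>u R' A'. ?Inv R' A' \<and> Suc (1 + (1 + u)) + ?\<Phi> R' A' \<le> ?\<Phi> R1 A1)"
    proof (rule wp_mono[OF wp_p], intro conjI)
      fix t R' A' assume a: "t \<le> c \<and> J (Suc k) A' \<and> std R' A' \<and> agree {2, 3, rG} ?R R'"
      then have r: "R' rPos = pos v + Suc k" "R' rEnd = pos v + deg v"
        using k(3) by (auto simp: agree_def)
      have "agree ?S R R'" using a ag by (auto simp: agree_def)
      then show "?Inv R' A'" using a r k(1) by (intro exI[of _ "Suc k"]) auto
      show "Suc (1 + (1 + t)) + ?\<Phi> R' A' \<le> ?\<Phi> R1 A1"
        using a r k(2,3) less by simp
    qed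
    then show "wp W L (Add rPos rPos rOne ;; Load rU rPos ;; p) R1 A1
        (\<lambda>t R' A'. ?Inv R' A' \<and> Suc t + ?\<Phi> R' A' \<le> ?\<Phi> R1 A1)"
      using k(2) std rd W_ge_L by (intro wp_rules) (auto simp: std_def)
  next
    fix t R' A' assume "?Inv R' A'" "\<not> R' rPos < R' rEnd" "t + ?\<Phi> R' A' \<le> Suc (?\<Phi> R1 A1)"
    moreover from this have "J (deg v) A'" by (auto dest: le_antisym)
    ultimately show "Q1 t R' A'" by (intro Q1) auto
  qed
  have pos: "pos v + deg v < L" "low (pos v) = deg v" "pos v < L" "A aPtr v = pos v"
    using input_nth[OF \<open>v < n\<close>, of 0] input_nth(1)[OF \<open>v < n\<close>, of "deg v"] assms(1,3)
    by (auto simp: low_def std_def)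
  show ?thesis
    unfolding foreach_def
    by (intro wp_rules loop)
      (use assms pos W_ge_L n_less_L in \<open>auto simp: std_def agree_def intro!: Q exI[of _ 0]\<close>)
qed

text \<open>
  \<open>S\<close> is the set of remaining vertices. The removed ones are entered from the end of \<open>ord\<close>
  backwards, so the vertices preceding \<open>ord i\<close> in the final order are those that remained when
  \<open>ord i\<close> was removed.
\<close>

definition peeled :: "nat \<Rightarrow> nat set \<Rightarrow> (nat \<Rightarrow> nat) \<Rightarrow> bool" where
  "peeled T S ord \<longleftrightarrow> S \<subseteq> {..<n} \<and> ord ` {card S..<n} = {..<n} - S \<and>
     (\<forall>i\<in>{card S..<n}. card (nbrs (ord i) \<inter> (S \<union> ord ` {card S..<i})) \<le> T)"

lemma peeled_mono: "peeled T S ord \<Longrightarrow> T \<le> T' \<Longrightarrow> peeled T' S ord"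
  unfolding peeled_def by (meson order_trans)

text \<open>\<open>v\<close> is entered right in front of the filled part of \<open>ord\<close>. For
  the older entries it merely moves from \<open>S\<close> into that part, so the sets preceding them
  are unchanged.\<close>

lemma peeled_remove:
  assumes "peeled T S ord" "v \<in> S" "card (nbrs v \<inter> S) \<le> T"
  shows "peeled T (S - {v}) (ord(card S - 1 := v))"
proof -
  let ?q = "card S" and ?ord = "ord(card S - 1 := v)"
  have fin: "finite S" using assms(1) finite_subset by (auto simp: peeled_def)
  have v: "v < n" using assms(1,2) by (auto simp: peeled_def)
  have q: "card (S - {v}) = ?q - 1" "0 < ?q" using fin assms(2) by (auto simp: card_gt_0_iff)
  have "?q \<le> n" using assms(1) card_mono[of "{..<n}" S] by (simp add: peeled_def)
  then have split: "{?q - 1..<i} = insert (?q - 1) {?q..<i}" if "?q \<le> i" for i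
    using q(2) that by auto
  have eq: "?ord ` {?q..<i} = ord ` {?q..<i}" for i
    by (rule image_cong) (use q(2) in auto)
  have "?ord ` {?q - 1..<n} = {..<n} - (S - {v})"
    using split[OF \<open>?q \<le> n\<close>] eq[of n] assms(1) v by (auto simp: peeled_def)
  moreover have "card (nbrs (?ord i) \<inter> (S - {v} \<union> ?ord ` {?q - 1..<i})) \<le> T"
    if i: "i \<in> {?q - 1..<n}" for i
  proof (cases "?q \<le> i")
    case True
    have "S - {v} \<union> ?ord ` {?q - 1..<i} = S \<union> ord ` {?q..<i}"
      using split[OF True] eq[of i] assms(2) by auto
    then show ?thesis using assms(1) True i q(2) by (simp add: peeled_def)
  next
    case False
    then have "i = ?q - 1" using i by auto
    moreover have "card (nbrs v \<inter> (S - {v})) \<le> card (nbrs v \<inter> S)" by (rule card_mono) auto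
    ultimately show ?thesis using assms(3) by simp
  qed
  ultimately show ?thesis using assms(1) unfolding peeled_def q(1) by blast
qed

section \<open>One scan over the remaining vertices\<close>

definition live :: "(nat \<Rightarrow> nat \<Rightarrow> nat) \<Rightarrow> nat \<Rightarrow> nat \<Rightarrow> nat \<Rightarrow> nat set" where
  "live A w j m = A aAct ` ({..<w} \<union> {j..<m})"

definition fresh :: "(nat \<Rightarrow> nat \<Rightarrow> nat) \<Rightarrow> bool" where
  "fresh A \<longleftrightarrow> A aCol = (\<lambda>_. 0) \<and> A aMark = (\<lambda>_. 0)"

text \<open>The cells from \<open>rK\<close> up to \<open>rJ\<close> are stale, so the remaining
  vertices are those of the compacted prefix and of the unread suffix. \<open>S0\<close> is their
  set at the start of the round; the last conjunct keeps degrees in \<open>S0\<close> for the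
  threshold argument.\<close>

definition scan_inv ::
  "nat set \<Rightarrow> nat \<Rightarrow> nat \<Rightarrow> (nat \<Rightarrow> nat) \<Rightarrow> (nat \<Rightarrow> nat \<Rightarrow> nat) \<Rightarrow> bool" where
  "scan_inv S0 T m R A \<longleftrightarrow> std R A \<and> fresh A \<and> m \<le> n \<and> R rThr = T \<and> R rAct = m \<and>
     R rJ \<le> m \<and> R rK \<le> R rJ \<and> inj_on (A aAct) ({..<R rK} \<union> {R rJ..<m}) \<and>
     live A (R rK) (R rJ) m \<subseteq> S0 \<and> R rTop = card (live A (R rK) (R rJ) m) \<and>
     peeled T (live A (R rK) (R rJ) m) (A aOrd) \<and>
     (\<forall>u\<in>live A (R rK) (R rJ) m. A aDeg u = card (nbrs u \<inter> live A (R rK) (R rJ) m)) \<and>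
     (\<forall>u\<in>A aAct ` {..<R rK}. T < card (nbrs u \<inter> S0))"

text \<open>\<open>f j\<close> moves down to cell \<open>w\<close>, which is stale unless
  \<open>w = j\<close>.\<close>

lemma scan_keep_sets:
  fixes f :: "nat \<Rightarrow> nat"
  assumes "w \<le> j" "j < m"
  shows "(f(w := f j)) ` ({..<Suc w} \<union> {Suc j..<m}) = f ` ({..<w} \<union> {j..<m})"
    and "inj_on f ({..<w} \<union> {j..<m}) \<Longrightarrow> inj_on (f(w := f j)) ({..<Suc w} \<union> {Suc j..<m})"
proof -
  have 1: "{..<Suc w} \<union> {Suc j..<m} = insert w ({..<w} \<union> {Suc j..<m})"
    and 2: "{..<w} \<union> {j..<m} = insert j ({..<w} \<union> {Suc j..<m})" using assms by auto
  have 3: "(f(w := f j)) ` ({..<w} \<union> {Suc j..<m}) = f ` ({..<w} \<union> {Suc j..<m})"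
    by (rule image_cong) (use assms in auto)
  show "(f(w := f j)) ` ({..<Suc w} \<union> {Suc j..<m}) = f ` ({..<w} \<union> {j..<m})"
    unfolding 1 2 image_insert 3 by simp
  assume inj: "inj_on f ({..<w} \<union> {j..<m})"
  have w: "w \<notin> {..<w} \<union> {Suc j..<m}" and j: "j \<notin> {..<w} \<union> {Suc j..<m}" using assms by auto
  have "inj_on (f(w := f j)) ({..<w} \<union> {Suc j..<m})"
    using inj w unfolding 2 by (auto simp: inj_on_def)
  moreover have "f j \<notin> f ` ({..<w} \<union> {Suc j..<m})"
    using inj j unfolding 2 by auto
  ultimately show "inj_on (f(w := f j)) ({..<Suc w} \<union> {Suc j..<m})"
    unfolding 1 using 3 w by auto
qed

lemma scan_drop_sets:
  fixes f :: "nat \<Rightarrow> nat"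
  assumes "w \<le> j" "j < m" "inj_on f ({..<w} \<union> {j..<m})"
  shows "f ` ({..<w} \<union> {Suc j..<m}) = f ` ({..<w} \<union> {j..<m}) - {f j}"
proof -
  have "{..<w} \<union> {j..<m} = insert j ({..<w} \<union> {Suc j..<m})" "j \<notin> {..<w} \<union> {Suc j..<m}"
    using assms by auto
  then show ?thesis using assms(3) by auto
qed

text \<open>Neighbours removed earlier are decremented as well, which is harmless because
  \<open>scan_inv\<close> speaks of the degrees of remaining vertices only.\<close>

lemma wp_decrement_nbrs:
  assumes "std R A" "R rV = v" "v < n"
    and Q: "\<And>t R'. std R' A' \<Longrightarrow> agree {2, 3, rU, rPos, rEnd, rG} R R' \<Longrightarrow>
      t \<le> 10 + 18 * deg v \<Longrightarrow> Q t R' A'"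
    and A': "A' = A(aDeg := (\<lambda>u. A aDeg u - of_bool (u \<in> nbrs v)))"
  shows "wp W L decrement_nbrs R A Q"
proof -
  define J where "J k A' \<longleftrightarrow>
    A' = A(aDeg := (\<lambda>u. A aDeg u - of_bool (u \<in> set (take k (Ns ! v)))))" for k A'
  show ?thesis
    unfolding decrement_nbrs_def
  proof (rule wp_foreach[where J = J and c = 15, OF assms(1-3)])
    fix k R1 A1 assume k: "k < deg v" and A1: "J k A1" "std R1 A1" and u: "R1 rU = Ns ! v ! k"
    have "Ns ! v ! k \<in> nbrs v" using k by (simp add: nbrs_def deg_def)
    then have lt: "Ns ! v ! k < n" using nbrs_subset[OF assms(3)] by auto
    \<comment> \<open>Distinctness ensures that no neighbour is decremented twice.\<close>
    have "distinct (Ns ! v)" using distinct_nbrs assms(3) by (simp add: n_def)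
    then have "Ns ! v ! k \<notin> set (take k (Ns ! v))"
      using k by (auto simp: in_set_conv_nth nth_eq_iff_index_eq deg_def)
    moreover have "take (Suc k) (Ns ! v) = take k (Ns ! v) @ [Ns ! v ! k]"
      using k by (simp add: take_Suc_conv_app_nth deg_def)
    ultimately have "J (Suc k) (A1(aDeg := (A1 aDeg)(Ns ! v ! k := A1 aDeg (Ns ! v ! k) - 1)))"
      using A1(1) by (auto simp: J_def fun_eq_iff)
    then show "wp W L (get rG aDeg rU ;; Sub rG rG rOne ;; put aDeg rU rG) R1 A1
        (\<lambda>t R'' A''. t \<le> 15 \<and> J (Suc k) A'' \<and> std R'' A'' \<and> agree {2, 3, rG} R1 R'')"
      by (intro wp_rules) (use A1(2) u lt W_ge_L n_less_L in \<open>auto simp: std_def agree_def\<close>)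
  next
    fix t R1 A1 assume "J (deg v) A1" "std R1 A1" "agree {2, 3, rU, rPos, rEnd, rG} R R1"
      "t \<le> 10 + (15 + 3) * deg v"
    moreover from this have "A1 = A'" by (simp add: J_def A' deg_def nbrs_def)
    ultimately show "Q t R1 A1" using Q by simp
  qed (simp add: J_def)
qed

text \<open>Reading a vertex costs at most 35 steps, removing it another 18 per neighbour. The
  degrees of the kept vertices stand on the left, so only removed ones are charged.\<close>

lemma wp_scan:
  assumes inv: "scan_inv S0 T m R A"
    and Q: "\<And>t R' A'. scan_inv S0 T m R' A' \<Longrightarrow> R' rJ = m \<Longrightarrow>
      t + 18 * sum deg (A' aAct ` {..<R' rK})
        \<le> 35 * (m - R rJ) + 18 * sum deg (live A (R rK) (R rJ) m) + 1 \<Longrightarrow> Q t R' A'"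
  shows "wp W L scan R A Q"
  unfolding scan_def
proof (rule wp_WhileLess[where Inv = "scan_inv S0 T m" and
      \<Phi> = "\<lambda>R A. 35 * (m - R rJ) + 18 * sum deg (live A (R rK) (R rJ) m)", OF inv])
  fix R A assume inv: "scan_inv S0 T m R A" and less: "R rJ < R rAct"
  define j w S v where "j = R rJ" and "w = R rK" and "S = live A w j m" and "v = A aAct j"
  have std: "std R A" and m: "m \<le> n" and fr: "fresh A" and R: "R rThr = T" "R rAct = m" "R rTop = card S"
    and jw: "j < m" "w \<le> j" and inj: "inj_on (A aAct) ({..<w} \<union> {j..<m})" and S0: "S \<subseteq> S0"
    and peeled: "peeled T S (A aOrd)" and deg: "\<And>u. u \<in> S \<Longrightarrow> A aDeg u = card (nbrs u \<inter> S)"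
    and kept: "\<And>u. u \<in> A aAct ` {..<w} \<Longrightarrow> T < card (nbrs u \<inter> S0)"
    using inv less by (auto simp: scan_inv_def j_def w_def S_def)
  have S: "S \<subseteq> {..<n}" using peeled by (simp add: peeled_def)
  then have finS: "finite S" using finite_subset by blast
  have cardS: "card S \<le> n" using card_mono[OF _ S] by simp
  have vS: "v \<in> S" using jw by (auto simp: S_def live_def v_def)
  then have v: "v < n" using S by auto
  have pos_cardS: "0 < card S" using vS finS by (auto simp: card_gt_0_iff)
  note bounds = jw v m cardS W_ge_L n_less_L
  define post where "post t R' A' \<longleftrightarrow> scan_inv S0 T m R' A' \<and>
    Suc t + (35 * (m - R' rJ) + 18 * sum deg (live A' (R' rK) (R' rJ) m))
      \<le> 35 * (m - j) + 18 * sum deg S" for t R' A'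
  define A1 where "A1 = A(aAct := (A aAct)(w := v))"
  have keep: "post t R' A1" if "T < A aDeg v" and R': "agree {2, 3, rV, rG, rK, rJ} R R'"
    "R' rK = Suc w" "R' rJ = Suc j" and t: "t \<le> 30" for t R'
  proof -
    have live: "live A1 (Suc w) (Suc j) m = S"
      using scan_keep_sets(1)[OF jw(2,1)] by (simp add: live_def S_def A1_def v_def)
    have "inj_on (A1 aAct) ({..<Suc w} \<union> {Suc j..<m})"
      using scan_keep_sets(2)[OF jw(2,1) inj] by (simp add: A1_def v_def)
    \<comment> \<open>The degree was read in the current set \<open>S\<close>, which is part of
      \<open>S0\<close>.\<close>
    moreover have "T < card (nbrs v \<inter> S0)"
    proof -
      have "card (nbrs v \<inter> S) \<le> card (nbrs v \<inter> S0)" using S0 by (intro card_mono) auto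
      then show ?thesis using that(1) deg[OF vS] by simp
    qed
    then have "T < card (nbrs u \<inter> S0)" if "u \<in> A1 aAct ` {..<Suc w}" for u
      using that kept by (auto simp: A1_def lessThan_Suc split: if_splits)
    moreover have "std R' A1" "fresh A1"
      using std fr R' by (auto simp: std_def agree_def A1_def fresh_def)
    ultimately have "scan_inv S0 T m R' A1"
      using R R' jw S0 peeled deg m unfolding scan_inv_def R'(2,3) live
      by (auto simp: agree_def A1_def)
    moreover have "m - j = Suc (m - Suc j)" using jw by simp
    ultimately show ?thesis using t unfolding post_def R'(2,3) live by simp
  qed
  define A2 where "A2 = A(aOrd := (A aOrd)(card S - 1 := v),
    aDeg := (\<lambda>u. A aDeg u - of_bool (u \<in> nbrs v)))"
  have drop: "post t R' A2" if "\<not> T < A aDeg v"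
    and R': "agree {2, 3, rV, rG, rTop, rU, rPos, rEnd, rJ} R R'"
    "R' rTop = card S - 1" "R' rJ = Suc j" and t: "t \<le> 34 + 18 * deg v" for t R'
  proof -
    have live: "live A2 w (Suc j) m = S - {v}"
      using scan_drop_sets[OF jw(2,1) inj] by (simp add: live_def S_def A2_def v_def)
    have "inj_on (A2 aAct) ({..<w} \<union> {Suc j..<m})"
      by (rule inj_on_subset[of _ "{..<w} \<union> {j..<m}"]) (use inj in \<open>auto simp: A2_def\<close>)
    moreover have "peeled T (S - {v}) (A2 aOrd)"
      using peeled_remove[OF peeled vS] that(1) deg[OF vS] by (simp add: A2_def)
    moreover have "A2 aDeg u = card (nbrs u \<inter> (S - {v}))" if u: "u \<in> S - {v}" for u
    proof -
      have "nbrs u \<inter> (S - {v}) = nbrs u \<inter> S - {v}" by auto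
      moreover have "v \<in> nbrs u \<longleftrightarrow> u \<in> nbrs v" using nbrs_commute[of v u] v u S by auto
      ultimately show ?thesis using deg[of u] u vS by (auto simp: A2_def card_Diff_singleton_if)
    qed
    moreover have "std R' A2" "fresh A2"
      using std fr R' by (auto simp: std_def agree_def A2_def fresh_def)
    moreover have rK: "R' rK = w" using R'(1) by (simp add: agree_def w_def)
    moreover have "card (S - {v}) = card S - 1" using vS finS by simp
    moreover have "T < card (nbrs u \<inter> S0)" if "u \<in> A2 aAct ` {..<w}" for u
      using that kept by (auto simp: A2_def)
    ultimately have "scan_inv S0 T m R' A2"
      using R R' jw S0 m unfolding scan_inv_def rK R'(3) live
      by (auto simp: agree_def)
    moreover have "m - j = Suc (m - Suc j)" using jw by simp
    moreover have "sum deg S = deg v + sum deg (S - {v})" using vS finS by (simp add: sum.remove)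
    ultimately show ?thesis using t unfolding post_def R'(3) rK live by simp
  qed
  have wp_dec: "wp W L decrement_nbrs
      R2 (A(aOrd := (A aOrd)(card S - 1 := v))) Q2"
    if "std R2 A" "R2 rV = v"
      and Q2: "\<And>t R'. agree {2, 3, rU, rPos, rEnd, rG} R2 R' \<Longrightarrow> t \<le> 10 + 18 * deg v \<Longrightarrow> Q2 t R' A2"
    for R2 Q2
    by (rule wp_decrement_nbrs[where A' = A2 and v = v])
      (use that v in \<open>auto simp: std_def A2_def\<close>)
  have "wp W L scan_step R A post"
    unfolding scan_step_def
    apply (intro wp_rules)
    using std R bounds
    apply (simp_all add: std_def j_def[symmetric] w_def[symmetric] v_def[symmetric] del: One_nat_def)
     apply (rule keep[unfolded A1_def]; simp add: agree_def w_def[symmetric] j_def[symmetric])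
    apply (intro wp_dec wp_rules)
    apply (simp_all add: std_def agree_def del: One_nat_def)
     apply (use \<open>j < m\<close> in \<open>simp add: j_def\<close>)
    apply (rule drop; auto simp: agree_def j_def)
    done
  then show "wp W L scan_step R A
      (\<lambda>t R' A'. scan_inv S0 T m R' A' \<and>
        Suc t + (35 * (m - R' rJ) + 18 * sum deg (live A' (R' rK) (R' rJ) m))
          \<le> 35 * (m - R rJ) + 18 * sum deg (live A (R rK) (R rJ) m))"
    by (simp add: j_def w_def S_def post_def[abs_def])
next
  fix t R' A'
  assume inv': "scan_inv S0 T m R' A'" and "\<not> R' rJ < R' rAct"
    and t: "t + (35 * (m - R' rJ) + 18 * sum deg (live A' (R' rK) (R' rJ) m))
      \<le> Suc (35 * (m - R rJ) + 18 * sum deg (live A (R rK) (R rJ) m))"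
  then have "R' rJ = m" by (simp add: scan_inv_def)
  then show "Q t R' A'" using t by (intro Q inv') (auto simp: live_def)
qed

section \<open>Threshold bound and amortized cost of the rounds\<close>

lemma threshold_step:
  assumes "S \<subseteq> {..<n}" "S' \<subseteq> S" "\<And>u. u \<in> S' \<Longrightarrow> T < card (nbrs u \<inter> S)" "card S < 2 * card S'"
  shows "real (Suc T) \<le> 2 * q" "Suc T \<le> n"
proof -
  have fin: "finite S" using assms(1) finite_subset by blast
  have "0 < card S'" using assms(4) by simp
  \<comment> \<open>Sparsity is applied to \<open>S\<close>, where the degrees of the survivors are
    counted; they are more than half of \<open>S\<close>, whence the factor 2.\<close>
  have "card S' * Suc T \<le> (\<Sum>u\<in>S'. card (nbrs u \<inter> S))"
    using sum_bounded_below[of S' "Suc T" "\<lambda>u. card (nbrs u \<inter> S)"] assms(3) by (simp add: Suc_le_eq)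
  also have "\<dots> \<le> (\<Sum>u\<in>S. card (nbrs u \<inter> S))" by (rule sum_mono2) (use fin assms(2) in auto)
  finally have "real (card S' * Suc T) \<le> real (\<Sum>u\<in>S. card (nbrs u \<inter> S))" by (rule of_nat_mono)
  also have "\<dots> \<le> q * real (card S)" using sparse[of S] assms(1) by (simp add: n_def nbrs_def)
  also have "\<dots> \<le> q * real (2 * card S')"
    using q_nonneg assms(4) by (intro mult_left_mono) auto
  finally have "real (card S') * real (Suc T) \<le> real (card S') * (2 * q)"
    by (simp add: algebra_simps)
  then show "real (Suc T) \<le> 2 * q"
    using \<open>0 < card S'\<close> by (meson mult_le_cancel_left_pos of_nat_0_less_iff)
  obtain u where u: "u \<in> S'" using \<open>0 < card S'\<close> by fastforce
  have "card (nbrs u \<inter> S) \<le> card {..<n}" using assms(1) by (intro card_mono) auto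
  then show "Suc T \<le> n" using assms(3)[OF u] by simp
qed

text \<open>
  A vertex pays 90 for its removal, which covers the rounds that remove at least half of the
  vertices, and 90 for each increase of the threshold that it survives with a larger degree.
\<close>

definition potential :: "nat \<Rightarrow> nat set \<Rightarrow> nat" where
  "potential T S = (\<Sum>v\<in>S. 90 + 18 * deg v + 90 * (deg v - T))"

lemma potential_eq:
  "finite S \<Longrightarrow> potential T S = 90 * card S + 18 * sum deg S + 90 * (\<Sum>v\<in>S. deg v - T)"
  by (simp add: potential_def sum.distrib sum_distrib_left)

text \<open>At least half of \<open>S\<close> disappears, and each removed vertex releases 90, which
  is 45 per vertex of \<open>S\<close>.\<close>

lemma potential_remove:
  assumes "finite S" "S' \<subseteq> S" "2 * card S' \<le> card S"
  shows "45 * card S + 18 * sum deg S + potential T S' \<le> potential T S + 18 * sum deg S'"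
proof -
  have "(\<Sum>v\<in>S'. deg v - T) \<le> (\<Sum>v\<in>S. deg v - T)" by (rule sum_mono2) (use assms in auto)
  then show ?thesis
    using assms by (simp add: potential_eq finite_subset[OF assms(2,1)])
qed

text \<open>Raising the threshold lowers \<open>deg v - T\<close> by exactly one for each survivor,
  whose degree exceeds \<open>T\<close>; with at least half surviving, this releases 45 per vertex
  of \<open>S\<close>.\<close>

lemma potential_threshold:
  assumes "finite S" "S' \<subseteq> S" "card S \<le> 2 * card S'" "\<And>u. u \<in> S' \<Longrightarrow> T < deg u"
  shows "45 * card S + 18 * sum deg S + potential (Suc T) S' \<le> potential T S + 18 * sum deg S'"
proof -
  have "(\<Sum>v\<in>S'. deg v - Suc T) + card S' = (\<Sum>v\<in>S'. (deg v - Suc T) + 1)"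
    by (simp add: sum_Suc)
  also have "\<dots> = (\<Sum>v\<in>S'. deg v - T)"
    by (rule sum.cong) (use assms(4) in fastforce)+
  also have "\<dots> \<le> (\<Sum>v\<in>S. deg v - T)" by (rule sum_mono2) (use assms in auto)
  finally have "(\<Sum>v\<in>S'. deg v - Suc T) + card S' \<le> (\<Sum>v\<in>S. deg v - T)" .
  moreover have "card S' \<le> card S" using assms by (simp add: card_mono)
  ultimately show ?thesis
    using assms by (simp add: potential_eq finite_subset[OF assms(2,1)])
qed

definition peel_inv :: "(nat \<Rightarrow> nat) \<Rightarrow> (nat \<Rightarrow> nat \<Rightarrow> nat) \<Rightarrow> bool" where
  "peel_inv R A \<longleftrightarrow> std R A \<and> fresh A \<and> R rAct \<le> n \<and> inj_on (A aAct) {..<R rAct} \<and>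
     peeled (R rThr) (A aAct ` {..<R rAct}) (A aOrd) \<and>
     (\<forall>u\<in>A aAct ` {..<R rAct}. A aDeg u = card (nbrs u \<inter> A aAct ` {..<R rAct})) \<and>
     real (R rThr) \<le> 2 * q \<and> R rThr \<le> n"

lemma wp_peel_round:
  assumes inv: "peel_inv R A" and "0 < R rAct"
  shows "wp W L peel_round R A (\<lambda>t R' A'. peel_inv R' A' \<and>
    Suc t + potential (R' rThr) (A' aAct ` {..<R' rAct}) \<le> potential (R rThr) (A aAct ` {..<R rAct}))"
proof -
  define m T S where "m = R rAct" and "T = R rThr" and "S = A aAct ` {..<m}"
  define post where "post t R' A' \<longleftrightarrow> peel_inv R' A' \<and>
    Suc t + potential (R' rThr) (A' aAct ` {..<R' rAct}) \<le> potential T S" for t R' A'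
  have std: "std R A" and fr: "fresh A" and m: "m \<le> n" "0 < m" and inj: "inj_on (A aAct) {..<m}"
    and peeled: "peeled T S (A aOrd)" and deg: "\<And>u. u \<in> S \<Longrightarrow> A aDeg u = card (nbrs u \<inter> S)"
    and T: "real T \<le> 2 * q" "T \<le> n"
    using assms by (auto simp: peel_inv_def m_def T_def S_def)
  have S: "S \<subseteq> {..<n}" using peeled by (simp add: peeled_def)
  have finS: "finite S" and cardS: "card S = m"
    using inj by (auto simp: S_def card_image)
  have live0: "live A 0 0 m = S"
    by (simp add: live_def S_def lessThan_atLeast0)
  let ?R1 = "R(rJ := 0, rK := 0, rTop := m)"
  have inv1: "scan_inv S T m ?R1 A"
    using std fr m inj peeled deg cardS
    by (auto simp: scan_inv_def live0[unfolded m_def] std_def m_def T_def lessThan_atLeast0)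
  \<comment> \<open>Both branches of the test lead here; 7 counts the steps of the round outside
    \<open>scan\<close>.\<close>
  have finish: "post k R2 A'"
    if inv': "scan_inv S T m R' A'" "R' rJ = m"
      and t: "t + 18 * sum deg (A' aAct ` {..<R' rK}) 
        \<le> 35 * (m - ?R1 rJ) + 18 * sum deg (live A (?R1 rK) (?R1 rJ) m) + 1"
      and R2: "agree {rG, rThr, rAct} R' R2" "R2 rAct = R' rK"
      "R2 rThr = (if m < 2 * R' rK then Suc T else T)" and k: "k = 7 + t"
    for t R' A' R2 k
  proof -
    define w S' where "w = R' rK" and "S' = A' aAct ` {..<w}"
    have "live A' w m m = S'" by (simp add: live_def S'_def)
    then have std': "std R' A'" and fr': "fresh A'" and w: "w \<le> m"
      and inj': "inj_on (A' aAct) {..<w}" and S': "S' \<subseteq> S" and peeled': "peeled T S' (A' aOrd)"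
      and deg': "\<And>u. u \<in> S' \<Longrightarrow> A' aDeg u = card (nbrs u \<inter> S')"
      and kept: "\<And>u. u \<in> S' \<Longrightarrow> T < card (nbrs u \<inter> S)"
      using inv' by (auto simp: scan_inv_def w_def[symmetric] S'_def[symmetric])
    have cardS': "card S' = w" using inj' by (simp add: S'_def card_image)
    have kept_deg: "T < deg u" if "u \<in> S'" for u
    proof -
      have "card (nbrs u \<inter> S) \<le> card (nbrs u)" by (rule card_mono) auto
      then show ?thesis using kept[OF that] card_nbrs[of u] that S' S by auto
    qed
    have thr: "real (R2 rThr) \<le> 2 * q" "R2 rThr \<le> n"
      using threshold_step[OF S S' kept] T unfolding R2(3) cardS cardS' w_def by auto
    have "std R2 A'" using std' R2(1) by (simp add: std_def agree_def)
    moreover have "peeled (R2 rThr) S' (A' aOrd)"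
      using R2(3) by (intro peeled_mono[OF peeled']) auto
    ultimately have "peel_inv R2 A'"
      using fr' w m inj' deg' thr unfolding peel_inv_def R2(2) w_def[symmetric] S'_def[symmetric]
      by auto
    \<comment> \<open>\<open>45 * m\<close> covers \<open>35 * m + 1\<close> for the scan, the 7
      other steps and the outer test, because \<open>m\<close> is positive.\<close>
    moreover have "45 * m + 18 * sum deg S + potential (R2 rThr) S' \<le> potential T S + 18 * sum deg S'"
      using potential_remove[OF finS S', of T] potential_threshold[OF finS S' _ kept_deg]
      unfolding R2(3) cardS cardS' w_def by auto
    ultimately show ?thesis
      using t m(2) unfolding k post_def R2(2) w_def[symmetric] S'_def[symmetric] by (simp add: live0)
  qed
  have "wp W L peel_round R A post"
    unfolding peel_round_def
    apply (intro wp_rules)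
    using std m W_ge_L n_less_L
         apply (simp_all add: std_def m_def[symmetric] del: One_nat_def)
    apply (rule wp_scan[OF inv1])
    apply (intro wp_rules)
    subgoal by (auto simp: scan_inv_def)
    subgoal using T by (auto simp: scan_inv_def std_def)
    subgoal by (auto simp: scan_inv_def std_def)
    subgoal by (rule finish, assumption, assumption, assumption) (auto simp: scan_inv_def std_def agree_def)
    subgoal by simp
    subgoal by (auto simp: scan_inv_def std_def)
    subgoal by (rule finish, assumption, assumption, assumption) (auto simp: scan_inv_def std_def agree_def)
    done
  then show ?thesis by (simp add: post_def[abs_def] T_def S_def m_def)
qed

lemma wp_peel:
  assumes std: "std R A" and "fresh A" and A: "\<And>v. v < n \<Longrightarrow> A aDeg v = deg v \<and> A aAct v = v"
    and Q: "\<And>t R' A'. std R' A' \<Longrightarrow> fresh A' \<Longrightarrow> peeled (R' rThr) {} (A' aOrd) \<Longrightarrow>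
      real (R' rThr) \<le> 2 * q \<Longrightarrow> t \<le> 3 + 90 * n + 108 * sum deg {..<n} \<Longrightarrow> Q t R' A'"
  shows "wp W L peel R A Q"
proof -
  let ?\<Phi> = "\<lambda>R A. potential (R rThr) (A aAct ` {..<R rAct})"
  have loop: "wp W L (WhileLess rZero rAct peel_round) R1 A1 Q1"
    if "peel_inv R1 A1" and Q1: "\<And>t R' A'. peel_inv R' A' \<Longrightarrow> R' rAct = 0 \<Longrightarrow> t \<le> Suc (?\<Phi> R1 A1) \<Longrightarrow> Q1 t R' A'"
    for R1 A1 Q1
  proof (rule wp_WhileLess[where Inv = peel_inv and \<Phi> = ?\<Phi>, OF that(1)])
    show "wp W L peel_round R A (\<lambda>t R' A'. peel_inv R' A' \<and> Suc t + ?\<Phi> R' A' \<le> ?\<Phi> R A)"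
      if "peel_inv R A" "R rZero < R rAct" for R A
      using that by (intro wp_peel_round) auto
    show "Q1 t R' A'" if "peel_inv R' A'" "\<not> R' rZero < R' rAct" "t + ?\<Phi> R' A' \<le> Suc (?\<Phi> R1 A1)"
      for t R' A'
      using that by (intro Q1) (auto simp: peel_inv_def std_def)
  qed
  have id: "A aAct ` {..<n} = {..<n}" using A by auto
  let ?R = "R(rThr := 0, rAct := n)"
  have "peel_inv ?R A"
    using std \<open>fresh A\<close> A q_nonneg card_nbrs nbrs_subset id
    by (auto simp: peel_inv_def std_def peeled_def inj_on_def Int_absorb2)
  \<comment> \<open>At threshold 0 the potential charges 18 and 90 per unit of degree, together
    108.\<close>
  moreover have "?\<Phi> ?R A \<le> 90 * n + 108 * sum deg {..<n}"
    by (simp add: id potential_eq)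
  ultimately have "wp W L (WhileLess rZero rAct peel_round) ?R A (\<lambda>u. Q (1 + (1 + u)))"
    by (intro loop Q) (auto simp: peel_inv_def)
  then show ?thesis
    unfolding peel_def
    using std W_ge_L n_less_L by (intro wp_rules) (auto simp: std_def)
qed

lemma input_le: "length input \<le> W" "x \<in> set input \<Longrightarrow> x \<le> W"
proof -
  show "length input \<le> W" using W_ge_L by (simp add: L_def)
  show "x \<le> W" if x: "x \<in> set input"
  proof -
    have "\<exists>v<n. x = deg v \<or> x \<in> nbrs v" if "x \<noteq> n"
      using x that unfolding input_def deg_def nbrs_def n_def by (fastforce simp: in_set_conv_nth[of _ Ns])
    then have "x \<le> n" using deg_less_n nbrs_subset by force
    then show ?thesis using n_less_L W_ge_L by simp
  qed
qed

section \<open>Greedy coloring along the order\<close>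

lemma wp_find_color:
  assumes std: "std R A" and s: "R rJ = s" and F: "\<And>c. s < A aMark c \<longleftrightarrow> c \<in> F"
    and "finite F" and b: "card (F - {0}) \<le> b" "b < n"
    and Q: "\<And>t R'. 1 \<le> R' rCol \<Longrightarrow> R' rCol \<le> b + 1 \<Longrightarrow> R' rCol \<notin> F \<Longrightarrow>
      agree {2, 3, rCol, rMark} R R' \<Longrightarrow> t \<le> 9 + 9 * b \<Longrightarrow> Q t R' A"
  shows "wp W L find_color R A Q"
proof -
  let ?Inv = "\<lambda>R' A'. A' = A \<and> agree {2, 3, rCol, rMark} R R' \<and> 1 \<le> R' rCol \<and>
    {1..<R' rCol} \<subseteq> F \<and> R' rMark = A aMark (R' rCol)"
  \<comment> \<open>All positive colors below the candidate are forbidden, and at most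
    \<open>b\<close> positive colors are, so the search ends by \<open>b + 1\<close>.\<close>
  have bound: "c \<le> b + 1" if "{1..<c} \<subseteq> F" for c
  proof -
    have "card {1..<c} \<le> card (F - {0})" using that \<open>finite F\<close> by (intro card_mono) auto
    then show ?thesis using b(1) by simp
  qed
  have loop: "wp W L (WhileLess rJ rMark (Add rCol rCol rOne ;; get rMark aMark rCol)) R1 A Q1"
    if "?Inv R1 A" "R1 rCol = 1" and Q1: "\<And>t R'. ?Inv R' A \<Longrightarrow> R' rCol \<notin> F \<Longrightarrow> t \<le> Suc (9 * b) \<Longrightarrow> Q1 t R' A"
    for R1 Q1
  proof (rule wp_WhileLess[where Inv = ?Inv and \<Phi> = "\<lambda>R' A'. 9 * (b + 1 - R' rCol)", OF that(1)])
    fix R1 A1 assume inv: "?Inv R1 A1" and "R1 rJ < R1 rMark"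
    then have "R1 rCol \<in> F" using F s by (simp add: agree_def)
    have "{1..<R1 rCol + 1} \<subseteq> F" using inv \<open>R1 rCol \<in> F\<close> by (auto simp: less_Suc_eq)
    then have "R1 rCol + 1 \<le> b + 1" by (rule bound)
    moreover have "b + 1 - R1 rCol = Suc (b + 1 - Suc (R1 rCol))" using calculation by simp
    ultimately show "wp W L (Add rCol rCol rOne ;; get rMark aMark rCol) R1 A1
        (\<lambda>t R' A'. ?Inv R' A' \<and> Suc t + 9 * (b + 1 - R' rCol) \<le> 9 * (b + 1 - R1 rCol))"
      using inv std W_ge_L n_less_L b(2) \<open>{1..<R1 rCol + 1} \<subseteq> F\<close>
      by (intro wp_rules) (auto simp: agree_def std_def)
  next
    fix t R' A'
    assume "?Inv R' A'" "\<not> R' rJ < R' rMark" "t + 9 * (b + 1 - R' rCol) \<le> Suc (9 * (b + 1 - R1 rCol))"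
    then show "Q1 t R' A'" using F s that(2) Q1[of R' t] by (auto simp: agree_def)
  qed
  show ?thesis
    unfolding find_color_def
    using std W_ge_L n_less_L b(2)
    by (intro wp_rules loop Q bound) (auto simp: std_def agree_def)
qed

text \<open>Colors at most \<open>n\<close> keep the addresses of the marks within the word
  bound.\<close>

lemma wp_mark_nbrs:
  assumes std: "std R A" "R rV = v" "v < n" and col: "\<And>u. u < n \<Longrightarrow> A aCol u \<le> n"
    and s: "R rK = Suc s"
    and Q: "\<And>t R' mk. (\<And>c. mk c = (if c \<in> A aCol ` nbrs v then Suc s else A aMark c)) \<Longrightarrow>
      agree {2, 3, rU, rPos, rEnd, rG} R R' \<Longrightarrow> t \<le> 10 + 17 * deg v \<Longrightarrow> Q t R' (A(aMark := mk))"
  shows "wp W L mark_nbrs R A Q"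
proof -
  define J where "J k A' \<longleftrightarrow> (\<exists>mk. A' = A(aMark := mk) \<and>
    (\<forall>c. mk c = (if c \<in> A aCol ` set (take k (Ns ! v)) then Suc s else A aMark c)))" for k A'
  show ?thesis
    unfolding mark_nbrs_def
  proof (rule wp_foreach[where J = J and c = 14, OF std])
    fix k R1 A1 assume k: "k < deg v" and A1: "J k A1" "std R1 A1" and u: "R1 rU = Ns ! v ! k"
      and ag: "agree {2, 3, rU, rPos, rEnd, rG} R R1"
    have "Ns ! v ! k \<in> nbrs v" using k by (simp add: nbrs_def deg_def)
    then have lt: "Ns ! v ! k < n" using nbrs_subset[OF std(3)] by auto
    obtain mk where mk: "A1 = A(aMark := mk)"
      "\<And>c. mk c = (if c \<in> A aCol ` set (take k (Ns ! v)) then Suc s else A aMark c)"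
      using A1(1) by (auto simp: J_def)
    have "take (Suc k) (Ns ! v) = take k (Ns ! v) @ [Ns ! v ! k]"
      using k by (simp add: take_Suc_conv_app_nth deg_def)
    then have "J (Suc k) (A(aMark := mk(A aCol (Ns ! v ! k) := Suc s)))"
      unfolding J_def using mk(2) by (intro exI[of _ "mk(A aCol (Ns ! v ! k) := Suc s)"]) auto
    then show "wp W L (get rG aCol rU ;; put aMark rG rK) R1 A1
        (\<lambda>t R'' A''. t \<le> 14 \<and> J (Suc k) A'' \<and> std R'' A'' \<and> agree {2, 3, rG} R1 R'')"
      using A1(2) u lt W_ge_L n_less_L col[OF lt] ag s unfolding mk(1)
      by (intro wp_rules) (auto simp: std_def agree_def)
  next
    fix t R1 A1 assume "J (deg v) A1" "std R1 A1" "agree {2, 3, rU, rPos, rEnd, rG} R R1"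
      "t \<le> 10 + (14 + 3) * deg v"
    then show "Q t R1 A1" using Q by (auto simp: J_def deg_def nbrs_def)
  qed (auto simp: J_def intro: exI[of _ "A aMark"])
qed

text \<open>Color 0 stands for uncolored. As no mark exceeds the position \<open>rJ\<close>, the
  stamp one above it is new.\<close>

definition greedy_inv ::
  "nat \<Rightarrow> (nat \<Rightarrow> nat) \<Rightarrow> (nat \<Rightarrow> nat) \<Rightarrow> (nat \<Rightarrow> nat \<Rightarrow> nat) \<Rightarrow> bool" where
  "greedy_inv T ord R A \<longleftrightarrow> std R A \<and> A aOrd = ord \<and> R rJ \<le> n \<and>
     (\<forall>v<n. v \<notin> ord ` {..<R rJ} \<longrightarrow> A aCol v = 0) \<and> (\<forall>v<n. A aCol v \<le> n) \<and>
     (\<forall>v\<in>ord ` {..<R rJ}. 1 \<le> A aCol v \<and> A aCol v \<le> T + 1) \<and>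
     (\<forall>u\<in>ord ` {..<R rJ}. \<forall>v\<in>ord ` {..<R rJ}. u \<in> nbrs v \<longrightarrow> A aCol u \<noteq> A aCol v) \<and>
     (\<forall>c. A aMark c \<le> R rJ)"

text \<open>The colored neighbours of \<open>v\<close> are those earlier in the order, at most
  \<open>T\<close> by \<open>peeled\<close>, so a color up to \<open>T + 1\<close> is free. Marking
  costs 17 steps per neighbour, the search at most 9 more.\<close>

lemma wp_greedy_step:
  assumes inv: "greedy_inv T ord R A" and less: "R rJ < n" and peeled: "peeled T {} ord"
  shows "wp W L greedy_step R A
    (\<lambda>t R' A'. greedy_inv T ord R' A' \<and> R' rJ = Suc (R rJ) \<and> Suc t \<le> 36 + 26 * deg (ord (R rJ)))"
proof -
  define s v D F where "s = R rJ" and "v = ord s" and "D = ord ` {..<s}" and "F = A aCol ` nbrs v"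
  define post where "post t R' A' \<longleftrightarrow> greedy_inv T ord R' A' \<and> R' rJ = Suc s \<and>
    Suc t \<le> 36 + 26 * deg v" for t R' A'
  have std: "std R A" and ord: "A aOrd = ord" and s: "s < n"
    and uncol: "\<And>u. u < n \<Longrightarrow> u \<notin> D \<Longrightarrow> A aCol u = 0" and col_le: "\<And>u. u < n \<Longrightarrow> A aCol u \<le> n"
    and col: "\<And>u. u \<in> D \<Longrightarrow> 1 \<le> A aCol u \<and> A aCol u \<le> T + 1"
    and proper: "\<And>u w. u \<in> D \<Longrightarrow> w \<in> D \<Longrightarrow> u \<in> nbrs w \<Longrightarrow> A aCol u \<noteq> A aCol w"
    and mark: "\<And>c. A aMark c \<le> s"
    using inv less by (auto simp: greedy_inv_def s_def D_def)
  have surj: "ord ` {..<n} = {..<n}"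
    using peeled by (simp add: peeled_def lessThan_atLeast0)
  then have inj: "inj_on ord {..<n}" by (intro eq_card_imp_inj_on) auto
  have v: "v < n" using surj s by (auto simp: v_def)
  have D: "D \<subseteq> {..<n}" using surj s by (auto simp: D_def)
  have vD: "v \<notin> D"
    using inj_on_image_mem_iff[OF inj, of s "{..<s}"] s by (auto simp: v_def D_def)
  have D_Suc: "ord ` {..<Suc s} = insert v D" by (simp add: D_def v_def lessThan_Suc)
  define b where "b = card (nbrs v \<inter> D)"
  have bT: "b \<le> T" using peeled s by (simp add: peeled_def b_def D_def v_def lessThan_atLeast0)
  have bdeg: "b \<le> deg v" using card_mono[of "nbrs v" "nbrs v \<inter> D"] card_nbrs[OF v] by (simp add: b_def)
  have bn: "b < n" using bdeg deg_less_n[OF v] by simp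
  have finF: "finite F" by (simp add: F_def)
  have cardF: "card (F - {0}) \<le> b"
  proof -
    \<comment> \<open>Later neighbours are uncolored and contribute only color 0.\<close>
    have "F - {0} \<subseteq> A aCol ` (nbrs v \<inter> D)"
      using uncol nbrs_subset[OF v] by (auto simp: F_def)
    then show ?thesis unfolding b_def by (rule surj_card_le[rotated]) simp
  qed
  have colored: "post k R' (A(aMark := mk, aCol := (A aCol)(v := c)))"
    if mk: "\<And>c. mk c = (if c \<in> F then Suc s else A aMark c)"
      and c: "1 \<le> c" "c \<le> b + 1" "c \<notin> F"
      and R': "agree {2, 3, rU, rPos, rEnd, rG, rCol, rMark, rV, rK, rJ} R R'" "R' rJ = Suc s"
      and k: "k \<le> 35 + 26 * deg v"
    for k R' mk c
  proof -
    let ?A = "A(aMark := mk, aCol := (A aCol)(v := c))"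
    have "std R' ?A" using std R' by (simp add: std_def agree_def)
    moreover have "\<forall>c. ?A aMark c \<le> Suc s"
      using mark mk by (simp add: le_SucI)
    moreover have "?A aCol u \<noteq> ?A aCol w" if uw: "u \<in> insert v D" "w \<in> insert v D" "u \<in> nbrs w" for u w
    proof -
      have "u < n" "w < n" using uw(1,2) v D by auto
      then have "w \<in> nbrs u" "u \<noteq> w" using uw(3) nbrs_commute not_in_nbrs by auto
      then show ?thesis using uw proper c(3) vD by (auto simp: F_def)
    qed
    ultimately have "greedy_inv T ord R' ?A"
      using ord s uncol col_le col c bT bn
      unfolding greedy_inv_def R'(2) D_Suc by auto
    then show ?thesis using R'(2) k by (simp add: post_def)
  qed
  have rest: "wp W L (find_color ;; put aCol rV rCol ;; Add rJ rJ rOne) R2 (A(aMark := mk))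
      (\<lambda>u. post (8 + (t + u)))"
    if mk: "\<And>c. mk c = (if c \<in> F then Suc s else A aMark c)"
      and R2: "agree {2, 3, rU, rPos, rEnd, rG, rV, rK} R R2" "R2 rV = v"
      and t: "t \<le> 10 + 17 * deg v" for t R2 mk
  proof (rule wp_Seq, rule wp_find_color[where F = F and b = b and s = s])
    show "std R2 (A(aMark := mk))" using std R2(1) by (simp add: std_def agree_def)
    show "R2 rJ = s" using R2(1) by (simp add: agree_def s_def)
    show "s < (A(aMark := mk)) aMark c \<longleftrightarrow> c \<in> F" for c using mk mark[of c] by auto
    fix ta R3
    assume c: "1 \<le> R3 rCol" "R3 rCol \<le> b + 1" "R3 rCol \<notin> F"
      and R3: "agree {2, 3, rCol, rMark} R2 R3" and ta: "ta \<le> 9 + 9 * b"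
    have R3_eq: "R3 0 = L" "R3 rOne = 1" "R3 rJ = s" "R3 rV = v"
      using R2 R3 std by (auto simp: agree_def std_def s_def)
    have "post (8 + (t + (ta + 8)))
        (R3(2 := 8 * v + L + 6, 3 := 6, rJ := Suc s)) (A(aMark := mk, aCol := (A aCol)(v := R3 rCol)))"
    proof (rule colored[OF mk c])
      show "8 + (t + (ta + 8)) \<le> 35 + 26 * deg v" using t ta bdeg by simp
    qed (use R2(1) R3 in \<open>auto simp: agree_def\<close>)
    then show "wp W L (put aCol rV rCol ;; Add rJ rJ rOne) R3 (A(aMark := mk))
        (\<lambda>u. post (8 + (t + (ta + u))))"
      using R3_eq v s W_ge_L n_less_L by (intro wp_rules) auto
  qed (use finF cardF bn in auto)
  have "wp W L greedy_step R A post"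
    unfolding greedy_step_def
    apply (intro wp_rules)
    using std s W_ge_L n_less_L
        apply (simp_all add: std_def s_def[symmetric] ord v_def[symmetric] del: One_nat_def)
    apply (rule wp_mark_nbrs[where v = v and s = s])
         apply (simp_all add: std_def v col_le del: One_nat_def)
    apply (rule rest; auto simp: F_def agree_def)
    done
  then show ?thesis by (simp add: post_def[abs_def] s_def v_def)
qed

lemma wp_greedy:
  assumes std: "std R A" and "fresh A" and peeled: "peeled T {} (A aOrd)"
    and Q: "\<And>t R' A'. std R' A' \<Longrightarrow> (\<And>v. v < n \<Longrightarrow> 1 \<le> A' aCol v \<and> A' aCol v \<le> T + 1) \<Longrightarrow>
      (\<And>u v. u < n \<Longrightarrow> v < n \<Longrightarrow> u \<in> nbrs v \<Longrightarrow> A' aCol u \<noteq> A' aCol v) \<Longrightarrow>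
      t \<le> 2 + 36 * n + 26 * sum deg {..<n} \<Longrightarrow> Q t R' A'"
  shows "wp W L greedy R A Q"
proof -
  define ord where "ord = A aOrd"
  have surj: "ord ` {..<n} = {..<n}"
    using peeled by (simp add: peeled_def ord_def lessThan_atLeast0)
  then have inj: "inj_on ord {..<n}" by (intro eq_card_imp_inj_on) auto
  let ?\<Phi> = "\<lambda>R A :: nat \<Rightarrow> nat \<Rightarrow> nat. \<Sum>i\<in>{R rJ..<n}. 36 + 26 * deg (ord i)"
  have "wp W L (WhileLess rJ rN greedy_step) (R(rJ := 0)) A (\<lambda>u. Q (1 + u))"
  proof (rule wp_WhileLess[where Inv = "greedy_inv T ord" and \<Phi> = ?\<Phi>])
    show "greedy_inv T ord (R(rJ := 0)) A"
      using std \<open>fresh A\<close> by (auto simp: greedy_inv_def fresh_def std_def ord_def)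
  next
    fix R A assume inv: "greedy_inv T ord R A" and "R rJ < R rN"
    then have less: "R rJ < n" by (simp add: greedy_inv_def std_def)
    have "?\<Phi> R A = 36 + 26 * deg (ord (R rJ)) + (\<Sum>i\<in>{Suc (R rJ)..<n}. 36 + 26 * deg (ord i))"
      using less by (simp add: sum.atLeast_Suc_lessThan)
    then show "wp W L greedy_step R A
        (\<lambda>t R' A'. greedy_inv T ord R' A' \<and> Suc t + ?\<Phi> R' A' \<le> ?\<Phi> R A)"
      using peeled by (intro wp_mono[OF wp_greedy_step[OF inv less]]) (auto simp: ord_def)
  next
    fix t R' A' assume inv: "greedy_inv T ord R' A'" and "\<not> R' rJ < R' rN"
      and t: "t + ?\<Phi> R' A' \<le> Suc (?\<Phi> (R(rJ := 0)) A)"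
    then have J: "R' rJ = n" by (simp add: greedy_inv_def std_def)
    have "(\<Sum>i<n. deg (ord i)) = sum deg {..<n}"
      using sum.reindex[OF inj, of deg] surj by simp
    then have "t \<le> 1 + 36 * n + 26 * sum deg {..<n}"
      using t J by (simp add: sum.distrib lessThan_atLeast0 flip: sum_distrib_left)
    then show "Q (1 + t) R' A'"
      using inv J surj by (intro Q) (auto simp: greedy_inv_def)
  qed
  then show ?thesis unfolding greedy_def by (intro wp_rules) auto
qed

section \<open>Output and the whole program\<close>

lemma wp_emit:
  assumes std: "std R A"
    and Q: "\<And>t R' A'. (\<And>v. v < n \<Longrightarrow> A' 8 v = A aCol v) \<Longrightarrow> R' 0 = n \<Longrightarrow> t \<le> 3 + 10 * n \<Longrightarrow> Q t R' A'"
  shows "wp W L emit R A Q"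
proof -
  let ?Inv = "\<lambda>R' A'. R' 0 = L \<and> R' rOne = 1 \<and> R' rZero = 0 \<and> R' rN = n \<and> R' rU \<le> n \<and>
    A' aCol = A aCol \<and> (\<forall>v<R' rU. A' 8 v = A aCol v)"
  have loop: "wp W L (WhileLess rU rN (get rG aCol rU ;; Store rU rG ;; Add rU rU rOne)) R1 A Q1"
    if "?Inv R1 A" "R1 rU = 0" and Q1: "\<And>t R' A'. ?Inv R' A' \<Longrightarrow> R' rU = n \<Longrightarrow> t \<le> Suc (10 * n) \<Longrightarrow> Q1 t R' A'"
    for R1 Q1
  proof (rule wp_WhileLess[where Inv = ?Inv and \<Phi> = "\<lambda>R A. 10 * (n - R rU)", OF that(1)])
    fix R A1 assume "?Inv R A1" "R rU < R rN"
    then show "wp W L (get rG aCol rU ;; Store rU rG ;; Add rU rU rOne) R A1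
        (\<lambda>t R' A'. ?Inv R' A' \<and> Suc t + 10 * (n - R' rU) \<le> 10 * (n - R rU))"
      using W_ge_L n_less_L by (intro wp_rules) (auto simp: less_Suc_eq)
  qed (use that in auto)
  show ?thesis
    unfolding emit_def
    by (intro wp_rules loop) (use std W_ge_L n_less_L in \<open>auto simp: std_def intro!: Q\<close>)
qed

text \<open>The costs of the four phases add up: 12 = 4 + 3 + 2 + 3, 162 = 26 + 90 + 36 + 10, and
  134 = 108 + 26.\<close>

lemma color_program_correct:
  obtains t f where "run W color_program input t (map f [0..<n])"
    "t \<le> 12 + 162 * n + 134 * sum deg {..<n}"
    "\<And>v. v < n \<Longrightarrow> 1 \<le> f v \<and> real (f v) \<le> 2 * q + 1"
    "\<And>u v. u < n \<Longrightarrow> v < n \<Longrightarrow> u \<in> nbrs v \<Longrightarrow> f u \<noteq> f v"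
proof -
  let ?R = "\<lambda>r :: nat. if r = 0 then L else 0"
  let ?A = "\<lambda>j :: nat. if j = 8 then low else (\<lambda>_. 0)"
  let ?post = "\<lambda>t R A. R 0 = n \<and> t \<le> 12 + 162 * n + 134 * sum deg {..<n} \<and>
    (\<forall>v<n. 1 \<le> A 8 v \<and> real (A 8 v) \<le> 2 * q + 1) \<and>
    (\<forall>u<n. \<forall>v<n. u \<in> nbrs v \<longrightarrow> A 8 u \<noteq> A 8 v)"
  have "wp W L color_program ?R ?A ?post"
    unfolding color_program_def
  proof (rule wp_Seq, rule wp_parse[OF refl refl], rule wp_Seq, rule wp_peel, assumption,
      goal_cases fresh init step)
    case (step t1 R1 A1 t2 R2 A2)
    show ?case
    proof (rule wp_Seq, rule wp_greedy[OF step(6-8)], rule wp_emit, assumption)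
      fix t3 R3 A3 t4 and R4 :: "nat \<Rightarrow> nat" and A4 :: "nat \<Rightarrow> nat \<Rightarrow> nat"
      assume col: "\<And>v. v < n \<Longrightarrow> 1 \<le> A3 aCol v \<and> A3 aCol v \<le> R2 rThr + 1"
        "\<And>u v. u < n \<Longrightarrow> v < n \<Longrightarrow> u \<in> nbrs v \<Longrightarrow> A3 aCol u \<noteq> A3 aCol v"
        and t: "t3 \<le> 2 + 36 * n + 26 * sum deg {..<n}" "t4 \<le> 3 + 10 * n"
        and out: "\<And>v. v < n \<Longrightarrow> A4 8 v = A3 aCol v" "R4 0 = n"
      have "real (A3 aCol v) \<le> 2 * q + 1" if "v < n" for v
        using col(1)[OF that] step(9) by linarith
      then show "?post (t1 + (t2 + (t3 + t4))) R4 A4"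
        using col out t step(5,10) by simp
    qed
  qed (auto simp: fresh_def)
  then obtain t R A where exec: "exec W color_program (?R, mem_of L ?A) t (R, mem_of L A)"
    and post: "?post t R A" unfolding wp_def by blast
  \<comment> \<open>The input in array 8 and zero-filled work arrays describe exactly the initial
    memory of \<open>run\<close>.\<close>
  have "mem_of L ?A = (\<lambda>i. if i < length input then input ! i else 0)"
  proof
    show "mem_of L ?A i = (if i < length input then input ! i else 0)" for i
      using mod_less_divisor[of 8 "i - L"] by (auto simp: mem_of_def low_def L_def)
  qed
  from exec[unfolded this] have "run W color_program input t (map (mem_of L A) [0..<n])"
    unfolding run_def L_def using post input_le
    by (intro conjI exI[of _ R] exI[of _ "mem_of (length input) A"]) auto
  moreover have "map (mem_of L A) [0..<n] = map (A 8) [0..<n]" using n_less_L by simp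
  ultimately have "run W color_program input t (map (A 8) [0..<n])" by simp
  then show ?thesis using that post by blast
qed

end

section \<open>From vertex numbers back to the graph\<close>

lemma adjacency_encoding_arcs:
  assumes "distinct vs" "S \<subseteq> {..<length vs}"
    and Ns: "\<And>i. i < length vs \<Longrightarrow> set (Ns ! i) = {j. j < length vs \<and> (vs ! i, vs ! j) \<in> parcs H}"
    and "finite (parcs H)"
  shows "(\<Sum>u\<in>S. card (set (Ns ! u) \<inter> S)) \<le> card (parcs H \<inter> (!) vs ` S \<times> (!) vs ` S)"
proof -
  have fin: "finite S" using assms(2) finite_subset by blast
  have "(\<Sum>u\<in>S. card (set (Ns ! u) \<inter> S)) = card (SIGMA u:S. set (Ns ! u) \<inter> S)"
    using fin by simp
  also have "\<dots> \<le> card (parcs H \<inter> (!) vs ` S \<times> (!) vs ` S)"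
  proof (rule card_inj_on_le)
    show "inj_on (\<lambda>(i, j). (vs ! i, vs ! j)) (SIGMA u:S. set (Ns ! u) \<inter> S)"
      using assms(1,2) by (auto simp: inj_on_def nth_eq_iff_index_eq subset_iff)
    show "(\<lambda>(i, j). (vs ! i, vs ! j)) ` (SIGMA u:S. set (Ns ! u) \<inter> S)
        \<subseteq> parcs H \<inter> (!) vs ` S \<times> (!) vs ` S"
      using assms(2) Ns by fastforce
    show "finite (parcs H \<inter> (!) vs ` S \<times> (!) vs ` S)" using assms(4) by simp
  qed
  finally show ?thesis .
qed

lemma linear_time_greedy_coloring:
  assumes H: "pair_graph H" and enc: "adjacency_encoding H vs xs" and "0 \<le> q"
    and sparse: "\<And>X. X \<subseteq> pverts H \<Longrightarrow> real (card (parcs H \<inter> X \<times> X)) \<le> q * real (card X)"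
  obtains t f where "run ((graph_size H + 2) ^ 6) color_program xs t (map f vs)"
    "t \<le> 268 * graph_size H + 12" "proper_coloring H f"
    "real (card (f ` pverts H)) \<le> 2 * q + 1"
proof -
  note h = pair_graphD[OF H]
  obtain Ns where vs: "distinct vs" "set vs = pverts H" and len: "length Ns = length vs"
    and Ns: "\<And>i. i < length vs \<Longrightarrow> distinct (Ns ! i)"
      "\<And>i. i < length vs \<Longrightarrow> set (Ns ! i) = {j. j < length vs \<and> (vs ! i, vs ! j) \<in> parcs H}"
    and xs: "xs = length vs # concat (map (\<lambda>N. length N # N) Ns)"
    using enc unfolding adjacency_encoding_def by blast
  have card_vs: "length vs = card (pverts H)" using vs by (metis distinct_card)
  have sub: "(!) vs ` S \<subseteq> pverts H" if "S \<subseteq> {..<length vs}" for S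
    using that vs(2) by (auto simp: subset_iff)
  have arcs: "sum_list (map length Ns) \<le> 2 * card (edges H)"
  proof -
    have "sum_list (map length Ns) = (\<Sum>i<length vs. card (set (Ns ! i) \<inter> {..<length vs}))"
      unfolding sum_list_sum_nth using len Ns
      by (intro sum.cong) (auto simp: Int_absorb2 subset_iff distinct_card[symmetric])
    also have "\<dots> \<le> card (parcs H \<inter> (!) vs ` {..<length vs} \<times> (!) vs ` {..<length vs})"
      by (intro adjacency_encoding_arcs vs Ns h(2)) auto
    also have "\<dots> \<le> card (parcs H)" using h(2) by (intro card_mono) auto
    finally show ?thesis using card_arcs_eq[OF h(2-4)] by simp
  qed
  let ?W = "(graph_size H + 2) ^ 6"
  \<comment> \<open>The left side is at most 32 times \<open>graph_size H + 2\<close>, and 32 is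
    \<open>2 ^ 5\<close>, hence at most the fifth power of that number; this explains the exponent
    6.\<close>
  have W: "9 * (1 + length Ns + sum_list (map length Ns)) + 8 \<le> ?W"
  proof -
    have "9 * (1 + length Ns + sum_list (map length Ns)) + 8 \<le> 2 ^ 5 * (graph_size H + 2)"
      using arcs by (simp add: graph_size_def len card_vs)
    also have "\<dots> \<le> (graph_size H + 2) ^ 5 * (graph_size H + 2)"
      by (intro mult_right_mono power_mono) auto
    finally show ?thesis by (simp add: power_Suc[symmetric] mult.commute del: power_Suc)
  qed
  interpret adjacency_lists Ns ?W q
  proof
    show "distinct (Ns ! v)" "set (Ns ! v) \<subseteq> {..<length Ns}" if "v < length Ns" for v
      using Ns that len by auto
    show "v \<in> set (Ns ! u)" if "u < length Ns" "v < length Ns" "u \<in> set (Ns ! v)" for u v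
      using Ns that len h(3) by (auto simp: sym_def)
    show "v \<notin> set (Ns ! v)" if "v < length Ns" for v
      using Ns that len h(4) by (auto simp: irrefl_def)
    show "real (\<Sum>u\<in>S. card (set (Ns ! u) \<inter> S)) \<le> q * real (card S)"
      if S: "S \<subseteq> {..<length Ns}" for S
    proof -
      have S': "S \<subseteq> {..<length vs}" using S len by simp
      have "inj_on ((!) vs) S"
        using S' vs(1) by (auto simp: inj_on_def nth_eq_iff_index_eq subset_iff)
      then have "card ((!) vs ` S) = card S" by (rule card_image)
      moreover have "real (\<Sum>u\<in>S. card (set (Ns ! u) \<inter> S))
          \<le> real (card (parcs H \<inter> (!) vs ` S \<times> (!) vs ` S))"
        by (rule of_nat_mono, rule adjacency_encoding_arcs[OF vs(1) S' Ns(2) h(2)])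
      ultimately show ?thesis using sparse[OF sub[OF S']] by simp
    qed
  qed (use \<open>0 \<le> q\<close> W in auto)
  have n: "n = length vs" by (simp add: n_def len)
  have input: "input = xs" by (simp add: input_def n xs)
  have sum_deg: "sum deg {..<n} \<le> 2 * card (edges H)"
    using arcs by (simp add: sum_list_sum_nth deg_def n_def lessThan_atLeast0)
  obtain t f where run: "run ?W color_program xs t (map f [0..<n])"
    and t: "t \<le> 12 + 162 * n + 134 * sum deg {..<n}"
    and f: "\<And>v. v < n \<Longrightarrow> 1 \<le> f v \<and> real (f v) \<le> 2 * q + 1"
      "\<And>u v. u < n \<Longrightarrow> v < n \<Longrightarrow> u \<in> nbrs v \<Longrightarrow> f u \<noteq> f v"
    using color_program_correct unfolding input by blast
  have bij: "bij_betw ((!) vs) {..<n} (pverts H)"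
    using bij_betw_nth[OF vs(1) n[THEN arg_cong, of lessThan] vs(2)[symmetric]] .
  \<comment> \<open>The coloring of indices is carried to the vertices by inverting the
    numbering.\<close>
  define g where "g x = f (the_inv_into {..<n} ((!) vs) x)" for x
  have g: "g (vs ! i) = f i" if "i < n" for i
    using the_inv_into_f_f[OF bij_betw_imp_inj_on[OF bij], of i] that by (simp add: g_def)
  have "map g vs = map f [0..<n]" by (rule nth_equalityI) (use g n in auto)
  moreover have "proper_coloring H g"
    unfolding proper_coloring_def
  proof clarify
    fix u v assume uv: "(u, v) \<in> parcs H" "g u = g v"
    then have "u \<in> pverts H" "v \<in> pverts H" using h(5) by auto
    then obtain i j where ij: "i < n" "j < n" "u = vs ! i" "v = vs ! j"
      using bij by (metis bij_betw_imp_surj_on imageE lessThan_iff)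
    then have "j \<in> nbrs i" using uv(1) Ns n by (simp add: nbrs_def)
    then show False using f(2)[OF ij(2,1)] uv(2) g ij by simp
  qed
  moreover have "real (card (g ` pverts H)) \<le> 2 * q + 1"
  proof -
    have "g ` pverts H = (\<lambda>i. g (vs ! i)) ` {..<n}"
      unfolding bij_betw_imp_surj_on[OF bij, symmetric] image_image ..
    \<comment> \<open>Colors start at 1, so their number is at most the largest one.\<close>
    also have "\<dots> \<subseteq> {1..nat \<lfloor>2 * q + 1\<rfloor>}"
    proof
      fix c assume "c \<in> (\<lambda>i. g (vs ! i)) ` {..<n}"
      then have "1 \<le> c" "real c \<le> 2 * q + 1" using f(1) g by auto
      then show "c \<in> {1..nat \<lfloor>2 * q + 1\<rfloor>}" using le_nat_floor[of c "2 * q + 1"] by simp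
    qed
    finally have "card (g ` pverts H) \<le> card {1..nat \<lfloor>2 * q + 1\<rfloor>}"
      by (intro card_mono) auto
    then have "card (g ` pverts H) \<le> nat \<lfloor>2 * q + 1\<rfloor>" by simp
    then show ?thesis using \<open>0 \<le> q\<close> by linarith
  qed
  \<comment> \<open>Each edge counts twice in the sum of degrees: 268 = 2 * 134, which also exceeds
    162.\<close>
  moreover have "t \<le> 268 * graph_size H + 12"
    using t sum_deg by (simp add: graph_size_def n card_vs)
  ultimately show ?thesis using run that[of t g] by simp
qed

theorem theorem6p1:
  fixes C :: "'a pair_pre_digraph set" and d :: nat
  assumes "\<forall>G\<in>C. pair_graph G"
    and "bounded_expansion C"
  shows "\<exists>(c::real) p. linear_time_algorithm p (induced_closure (class_power C d)) (coloring_output c)"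
proof -
  obtain c :: real where c: "c \<ge> 0"
    and sparse: "\<And>H X. H \<in> induced_closure (class_power C d) \<Longrightarrow> X \<subseteq> pverts H \<Longrightarrow>
      real (card (parcs H \<inter> X \<times> X)) \<le> c * real (chromatic_number H) * real (card X)"
    using induced_power_sparse[OF assms] by blast
  have "\<exists>t ys. run ((graph_size H + 2) ^ 6) color_program xs t ys \<and>
      t \<le> 268 * graph_size H + 12 \<and> coloring_output (2 * c + 1) H vs ys"
    if H: "H \<in> induced_closure (class_power C d)" and enc: "adjacency_encoding H vs xs" for H vs xs
  proof -
    have pg: "pair_graph H"
      using pair_graph_induced_closure_power[OF assms(1) H] by blast
    let ?\<chi> = "chromatic_number H"
    obtain t f where run: "run ((graph_size H + 2) ^ 6) color_program xs t (map f vs)"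
        "t \<le> 268 * graph_size H + 12" "proper_coloring H f"
      and card: "real (card (f ` pverts H)) \<le> 2 * (c * real ?\<chi>) + 1"
      using linear_time_greedy_coloring[OF pg enc _ sparse[OF H]] c by auto
    \<comment> \<open>A nonempty graph has chromatic number at least 1, which absorbs the additive 1
      into the factor; without vertices no color is used.\<close>
    have "real (card (f ` pverts H)) \<le> (2 * c + 1) * real ?\<chi>"
    proof (cases "pverts H = {}")
      case False
      obtain g where "g ` pverts H \<subseteq> {..<?\<chi>}" using optimal_coloring[OF pg] by blast
      then have "1 \<le> ?\<chi>" using False by (cases ?\<chi>) auto
      then show ?thesis using card by (simp add: algebra_simps)
    qed (use c in simp)
    then show ?thesis using run unfolding coloring_output_def by blast
  qed
  then show ?thesis unfolding linear_time_algorithm_def by blast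
qed

end
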